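(* Let $\nabla$ be a connection on $TM$ with Christoffel symbol $\Gamma_\varphi$ in a chart $(U,\varphi)$, and let $\widetilde\nabla$ be the (special second-order) connection on $T^{(2)}M$ induced by $\nabla$. Then $\widetilde\nabla$ has Christoffel symbols in $(U,\varphi)$ given, for all smooth vector fields $X,Y,Z$, by $$C_\varphi(X_\varphi,Y_\varphi,Z_\varphi)=X_\varphi\Delta\Gamma_\varphi(Y_\varphi,Z_\varphi)+Y_\varphi\Delta\Gamma_\varphi(X_\varphi,Z_\varphi)+Z_\varphi\Delta\Gamma_\varphi(X_\varphi,Y_\varphi)$$ and $$R_\varphi(X_\varphi,Y_\varphi,Z_\varphi)=D[\Gamma_\varphi(Y_\varphi,Z_\varphi)]\cdot X_\varphi-\Gamma_\varphi((\nabla_XY)_\varphi,Z_\varphi)-\Gamma_\varphi(Y_\varphi,(\nabla_XZ)_\varphi).$$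
   Context: $M$ is a Hausdorff, paracompact, smooth manifold modelled on a finite-dimensional Banach space $\mathbf E$. For a chart $(U,\varphi)$: $f_\varphi=f\circ\varphi^{-1}$, and $X_\varphi:\varphi U\to\mathbf E$ is the local representative of a vector field $X$. The Christoffel symbol $\Gamma_\varphi$ of a Koszul connection $\nabla$ on $TM$ is defined by the sign convention $(\nabla_XY)_\varphi=DY_\varphi\cdot X_\varphi-\Gamma_\varphi(X_\varphi,Y_\varphi)$. In the formula for $R_\varphi$, $D[\Gamma_\varphi(Y_\varphi,Z_\varphi)]\cdot X_\varphi$ is the derivative in the direction $X_\varphi$ of the $\mathbf E$-valued function $u\mapsto\Gamma_\varphi(u)(Y_\varphi(u),Z_\varphi(u))$. For $f$ smooth, $\nabla f=df$, $\nabla^2f(Y,Z)=Y\cdot Z\cdot f-(\nabla_YZ)\cdot f$, and $\nabla^3f(X,Y,Z)=X\cdot(\nabla^2f(Y,Z))-\nabla^2f(\nabla_XY,Z)-\nabla^2f(Y,\nabla_XZ)$. Second-order tangent bundle. $\mathbf E\Delta\mathbf E$ is the symmetric tensor product of $\mathbf E$ with itself, with product $y\Delta z=z\Delta y$; symmetric bilinear maps on $\mathbf E\times\mathbf E$ are identified with linear maps on $\mathbf E\Delta\mathbf E$, so $D^2F(u)\cdot(y\Delta z)=D^2F(u)(y,z)$; for linear $A$, $(A\Delta A)(y\Delta z)=Ay\Delta Az$. $T^{(2)}M$ is the vector bundle over $M$ with fibre $\mathbf E\oplus(\mathbf E\Delta\mathbf E)$ whose local representatives $e\oplus s$ in a chart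 $\varphi$ and $\bar e\oplus\bar s$ in a chart $\psi$ of the same element over $m$ are related, with $F=\psi\circ\varphi^{-1}$ and $u=\varphi m$, by $\bar e=DF(u)\cdot e+D^2F(u)\cdot s$ and $\bar s=(DF(u)\Delta DF(u))\cdot s$. Special second-order connections. A connection $\widetilde\nabla$ on $T^{(2)}M$ is a Koszul connection on this vector bundle; in a chart $(\widetilde\nabla_X\tau)_\varphi=D\tau_\varphi\cdot X_\varphi-\widetilde\Gamma_\varphi(X_\varphi,\tau_\varphi)$. It is a special second-order connection if in every chart $\widetilde\Gamma_\varphi(X_\varphi,V_\varphi\oplus S_\varphi)=R_\varphi(X_\varphi,S_\varphi)\oplus(-X_\varphi\Delta V_\varphi+C_\varphi(X_\varphi,S_\varphi))$ with $R_\varphi$ valued in $\mathbf E$, $C_\varphi$ valued in $\mathbf E\Delta\mathbf E$, both bilinear and smooth in the base point (the Christoffel symbols of $\widetilde\nabla$). One writes $R_\varphi(X,Y,Z)=R_\varphi(X,Y\Delta Z)$, $C_\varphi(X,Y,Z)=C_\varphi(X,Y\Delta Z)$. Induced connection. The connection induced by $\nabla$ is the special second-order connection $\widetilde\nabla$ on $T^{(2)}M$ associated to the third-order Hessian structure $K f=\nabla^3f$, i.e. the one whose Christoffel symbols satisfy, in every chart and for all smooth $f$ and vector fields $X,Y,Z$, $\nabla^3f(X,Y,Z)=D^3f_\varphi(X_\varphi,Y_\varphi,Z_\varphi)+D^2f_\varphi\cdot C_\varphi(X_\varphi,Y_\varphi,Z_\varphi)+Df_\varphi\cdot R_\varphi(X_\varphi,Y_\varphi,Z_\varphi)$.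 *)

theory Defs
  imports "HOL-Analysis.Analysis"
begin

section \<open>Finite-dimensional Banach spaces\<close>

class finite_dim_banach = banach +
  assumes finite_spanning: "\<exists>B. finite B \<and> (\<forall>x. \<exists>c. x = (\<Sum>b\<in>B. c b *\<^sub>R b))"

lemma finite_dim: "\<exists>B::'a::finite_dim_banach set. finite B \<and> span B = UNIV"
proof -
  obtain B :: "'a set" where B: "finite B" "\<And>x. \<exists>c. x = (\<Sum>b\<in>B. c b *\<^sub>R b)"
    using finite_spanning by blast
  have "x \<in> span B" for x
    using B(2)[of x] by (auto intro: span_sum span_scale span_base)
  with B(1) show ?thesis by blast
qed

instance real :: finite_dim_banach
proof
  show "\<exists>B::real set. finite B \<and> (\<forall>x. \<exists>c. x = (\<Sum>b\<in>B. c b *\<^sub>R b))"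
    by (rule exI[of _ "{1}"]) auto
qed

lemma coordinates_bounded:
  fixes B :: "'a::banach set"
  assumes "finite B" "independent B"
  shows "\<exists>K>0. \<forall>c. (\<Sum>b\<in>B. \<bar>c b\<bar>) \<le> K * norm (\<Sum>b\<in>B. c b *\<^sub>R b)"
  using assms
proof (induction B rule: finite_induct)
  case empty
  then show ?case by (auto intro: exI[of _ 1])
next
  case (insert a B)
  have indB: "independent B" and aB: "a \<notin> span B"
    using insert by (auto simp: independent_insert)
  obtain K where K: "K > 0" "\<And>c. (\<Sum>b\<in>B. \<bar>c b\<bar>) \<le> K * norm (\<Sum>b\<in>B. c b *\<^sub>R b)"
    using insert.IH[OF indB] by blast
  have spanB: "span B = range (\<lambda>c. \<Sum>b\<in>B. c b *\<^sub>R b)"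
    using span_finite[OF \<open>finite B\<close>] by simp
  have "closed (span B)"
  proof (unfold closed_sequential_limits, intro allI impI, elim conjE)
    fix x :: "nat \<Rightarrow> 'a" and l assume x: "\<forall>n. x n \<in> span B" "x \<longlonglongrightarrow> l"
    have "\<exists>c. \<forall>n. x n = (\<Sum>b\<in>B. c n b *\<^sub>R b)"
      using x(1) unfolding spanB by (intro choice) blast
    then obtain c where c: "\<And>n. x n = (\<Sum>b\<in>B. c n b *\<^sub>R b)" by blast
    have "Cauchy x" using x(2) LIMSEQ_imp_Cauchy by blast
    have "convergent (\<lambda>n. c n b)" if b: "b \<in> B" for b
    proof -
      have est: "\<bar>c m b - c n b\<bar> \<le> K * norm (x m - x n)" for m n
      proof -
        have "\<bar>c m b - c n b\<bar> \<le> (\<Sum>b\<in>B. \<bar>c m b - c n b\<bar>)"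
          using b \<open>finite B\<close> by (intro member_le_sum) auto
        also have "\<dots> \<le> K * norm (\<Sum>b\<in>B. (c m b - c n b) *\<^sub>R b)"
          using K(2)[of "\<lambda>b. c m b - c n b"] by simp
        also have "(\<Sum>b\<in>B. (c m b - c n b) *\<^sub>R b) = x m - x n"
          by (simp add: c scaleR_diff_left sum_subtractf)
        finally show ?thesis .
      qed
      have "Cauchy (\<lambda>n. c n b)"
      proof (rule CauchyI)
        fix e :: real assume "e > 0"
        then have "e / K > 0" using K by simp
        then obtain M where M: "\<And>m n. m \<ge> M \<Longrightarrow> n \<ge> M \<Longrightarrow> norm (x m - x n) < e / K"
          using CauchyD[OF \<open>Cauchy x\<close>] by blast
        show "\<exists>M. \<forall>m\<ge>M. \<forall>n\<ge>M. norm (c m b - c n b) < e"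
        proof (intro exI[of _ M] allI impI)
          fix m n assume "m \<ge> M" "n \<ge> M"
          from M[OF this] have "K * norm (x m - x n) < e"
            using K(1) by (simp add: field_simps)
          then show "norm (c m b - c n b) < e" using est[of m n] by simp
        qed
      qed
      then show ?thesis by (simp add: Cauchy_convergent_iff)
    qed
    then have "\<forall>b\<in>B. \<exists>d. (\<lambda>n. c n b) \<longlonglongrightarrow> d" by (auto simp: convergent_def)
    then obtain d where d: "\<And>b. b \<in> B \<Longrightarrow> (\<lambda>n. c n b) \<longlonglongrightarrow> d b" by metis
    have "x \<longlonglongrightarrow> (\<Sum>b\<in>B. d b *\<^sub>R b)"
      unfolding c by (intro tendsto_sum tendsto_scaleR d tendsto_const)
    then have "l = (\<Sum>b\<in>B. d b *\<^sub>R b)" using x(2) LIMSEQ_unique by blast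
    then show "l \<in> span B" unfolding spanB by blast
  qed
  moreover have ne: "span B \<noteq> {}" using span_zero by blast
  ultimately have \<delta>: "infdist a (span B) > 0" (is "?\<delta> > 0")
    using aB by (metis in_closed_iff_infdist_zero infdist_nonneg less_eq_real_def)
  have ca: "\<bar>t\<bar> * ?\<delta> \<le> norm (t *\<^sub>R a + s)" if "s \<in> span B" for t s
  proof (cases "t = 0")
    case False
    have "(- inverse t) *\<^sub>R s \<in> span B" using that by (rule span_scale)
    then have "?\<delta> \<le> dist a ((- inverse t) *\<^sub>R s)" by (rule infdist_le)
    also have "\<dots> = norm (a + inverse t *\<^sub>R s)" by (simp add: dist_norm)
    finally have "\<bar>t\<bar> * ?\<delta> \<le> norm (t *\<^sub>R (a + inverse t *\<^sub>R s))"
      by (simp add: mult_left_mono)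
    then show ?thesis using False by (simp add: scaleR_add_right)
  qed auto
  define L where "L = 1 / ?\<delta> + K * (1 + norm a / ?\<delta>)"
  have "L > 0" unfolding L_def using \<delta> K(1) by (intro add_pos_nonneg) auto
  moreover have "(\<Sum>b\<in>insert a B. \<bar>c b\<bar>) \<le> L * norm (\<Sum>b\<in>insert a B. c b *\<^sub>R b)" for c
  proof -
    define s where "s = (\<Sum>b\<in>B. c b *\<^sub>R b)"
    define N where "N = norm (c a *\<^sub>R a + s)"
    have "s \<in> span B" unfolding s_def spanB by blast
    from ca[OF this, of "c a"] have 1: "\<bar>c a\<bar> \<le> N / ?\<delta>"
      using \<delta> by (simp add: N_def field_simps)
    have "norm s \<le> N + norm (c a *\<^sub>R a)"
      using norm_triangle_ineq4[of "c a *\<^sub>R a + s" "c a *\<^sub>R a"] by (simp add: N_def)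
    also have "\<dots> \<le> N + N / ?\<delta> * norm a"
      using mult_right_mono[OF 1 norm_ge_zero[of a]] by simp
    finally have "K * norm s \<le> K * (N + N / ?\<delta> * norm a)" using K(1) by simp
    then have "(\<Sum>b\<in>B. \<bar>c b\<bar>) \<le> K * (N + N / ?\<delta> * norm a)"
      using K(2)[of c] by (simp add: s_def)
    with 1 have "\<bar>c a\<bar> + (\<Sum>b\<in>B. \<bar>c b\<bar>) \<le> L * N"
      by (simp add: L_def algebra_simps)
    then show ?thesis using insert.hyps by (simp add: N_def s_def)
  qed
  ultimately show ?case by blast
qed

lemma linear_functional_bounded:
  fixes f :: "'a::finite_dim_banach \<Rightarrow> real"
  assumes f: "linear f"
  shows "bounded_linear f"
proof -
  obtain B0 :: "'a set" where B0: "finite B0" "span B0 = UNIV" using finite_dim by blast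
  obtain B where B: "B \<subseteq> B0" "independent B" "B0 \<subseteq> span B"
    using maximal_independent_subset[of B0] by metis
  have fin: "finite B" using B B0 finite_subset by blast
  have spanB: "span B = UNIV"
    using B(3) B0(2) by (metis span_mono span_span top.extremum_uniqueI)
  obtain K where K: "K > 0" "\<And>c. (\<Sum>b\<in>B. \<bar>c b\<bar>) \<le> K * norm (\<Sum>b\<in>B. c b *\<^sub>R b)"
    using coordinates_bounded[OF fin B(2)] by blast
  define M where "M = (\<Sum>b\<in>B. \<bar>f b\<bar>)"
  have "\<bar>f x\<bar> \<le> norm x * (K * M)" for x
  proof -
    have "x \<in> range (\<lambda>c. \<Sum>b\<in>B. c b *\<^sub>R b)"
      using span_finite[OF fin] spanB by auto
    then obtain c where c: "x = (\<Sum>b\<in>B. c b *\<^sub>R b)" by blast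
    have "f x = (\<Sum>b\<in>B. c b * f b)"
      by (simp add: c linear_sum[OF f] linear_cmul[OF f])
    then have "\<bar>f x\<bar> \<le> (\<Sum>b\<in>B. \<bar>c b * f b\<bar>)" by simp
    also have "\<dots> \<le> (\<Sum>b\<in>B. \<bar>c b\<bar> * M)"
      unfolding abs_mult M_def using fin
      by (intro sum_mono mult_left_mono member_le_sum) auto
    also have "\<dots> = (\<Sum>b\<in>B. \<bar>c b\<bar>) * M" by (simp add: sum_distrib_right)
    also have "\<dots> \<le> (K * norm x) * M"
      using K(2)[of c] by (intro mult_right_mono) (auto simp: c M_def intro: sum_nonneg)
    finally show ?thesis by (simp add: mult_ac)
  qed
  then show ?thesis
    using f by (auto simp: bounded_linear_def bounded_linear_axioms_def)
qed

section \<open>The symmetric tensor product \<open>E \<Delta> E\<close>\<close>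

text \<open>A tensor \<open>y \<otimes> z\<close> acts as the map \<open>E\<^sup>* \<rightarrow> E\<close>, \<open>l \<mapsto> l(y) z\<close>. The product \<open>y \<Delta> z\<close> is the
  symmetrisation \<open>(y \<otimes> z + z \<otimes> y) / 2\<close>; these products span the symmetric tensors.\<close>

lift_definition sym_prod_blinfun ::
  "'e::real_normed_vector \<Rightarrow> 'e \<Rightarrow> ('e \<Rightarrow>\<^sub>L real) \<Rightarrow>\<^sub>L 'e"
  is "\<lambda>y z l. (1/2) *\<^sub>R (blinfun_apply l y *\<^sub>R z + blinfun_apply l z *\<^sub>R y)"
  by (intro bounded_linear_intros)

typedef (overloaded) 'e sym_tensor =
  "span {sym_prod_blinfun y z | y z. True} :: (('e::real_normed_vector \<Rightarrow>\<^sub>L real) \<Rightarrow>\<^sub>L 'e) set"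
  using span_zero by blast

setup_lifting type_definition_sym_tensor

instantiation sym_tensor :: (real_normed_vector) real_normed_vector
begin

lift_definition zero_sym_tensor :: "'a sym_tensor" is 0 by (rule span_zero)
lift_definition plus_sym_tensor :: "'a sym_tensor \<Rightarrow> 'a sym_tensor \<Rightarrow> 'a sym_tensor"
  is "(+)" by (rule span_add)
lift_definition minus_sym_tensor :: "'a sym_tensor \<Rightarrow> 'a sym_tensor \<Rightarrow> 'a sym_tensor"
  is "(-)" by (rule span_diff)
lift_definition uminus_sym_tensor :: "'a sym_tensor \<Rightarrow> 'a sym_tensor"
  is uminus by (rule span_neg)
lift_definition scaleR_sym_tensor :: "real \<Rightarrow> 'a sym_tensor \<Rightarrow> 'a sym_tensor"
  is scaleR by (rule span_scale)
lift_definition norm_sym_tensor :: "'a sym_tensor \<Rightarrow> real" is norm .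

definition dist_sym_tensor :: "'a sym_tensor \<Rightarrow> 'a sym_tensor \<Rightarrow> real"
  where "dist_sym_tensor s t = norm (s - t)"
definition sgn_sym_tensor :: "'a sym_tensor \<Rightarrow> 'a sym_tensor"
  where "sgn_sym_tensor s = inverse (norm s) *\<^sub>R s"
definition uniformity_sym_tensor :: "('a sym_tensor \<times> 'a sym_tensor) filter"
  where "uniformity_sym_tensor = (INF e\<in>{0<..}. principal {(s, t). dist s t < e})"
definition open_sym_tensor :: "'a sym_tensor set \<Rightarrow> bool"
  where "open_sym_tensor S \<longleftrightarrow> (\<forall>s\<in>S. \<forall>\<^sub>F (s', t) in uniformity. s' = s \<longrightarrow> t \<in> S)"

instance
proof
  fix a b :: real and s t v :: "'a sym_tensor" and U :: "'a sym_tensor set"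
  show "s + t + v = s + (t + v)" by transfer (rule add.assoc)
  show "s + t = t + s" by transfer (rule add.commute)
  show "0 + s = s" by transfer simp
  show "- s + s = 0" by transfer simp
  show "s - t = s + - t" by transfer simp
  show "a *\<^sub>R (s + t) = a *\<^sub>R s + a *\<^sub>R t" by transfer (rule scaleR_add_right)
  show "(a + b) *\<^sub>R s = a *\<^sub>R s + b *\<^sub>R s" by transfer (rule scaleR_add_left)
  show "a *\<^sub>R b *\<^sub>R s = (a * b) *\<^sub>R s" by transfer simp
  show "1 *\<^sub>R s = s" by transfer simp
  show "dist s t = norm (s - t)" by (rule dist_sym_tensor_def)
  show "sgn s = inverse (norm s) *\<^sub>R s" by (rule sgn_sym_tensor_def)
  show "uniformity = (INF e\<in>{0<..}. principal {(s::'a sym_tensor, t). dist s t < e})"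
    by (rule uniformity_sym_tensor_def)
  show "open U = (\<forall>s\<in>U. \<forall>\<^sub>F (s', t) in uniformity. s' = s \<longrightarrow> t \<in> U)"
    by (rule open_sym_tensor_def)
  show "(norm s = 0) = (s = 0)" by transfer simp
  show "norm (s + t) \<le> norm s + norm t" by transfer (rule norm_triangle_ineq)
  show "norm (a *\<^sub>R s) = \<bar>a\<bar> * norm s" by transfer simp
qed

end

lift_definition sym_prod ::
  "'e::real_normed_vector \<Rightarrow> 'e \<Rightarrow> 'e sym_tensor"  (infixl "\<triangle>" 75)
  is sym_prod_blinfun by (blast intro: span_base)

lemma sym_prod_commute: "y \<triangle> z = z \<triangle> y"
  by transfer (simp add: blinfun_eqI sym_prod_blinfun.rep_eq add.commute)

lemma bilinear_sym_prod: "bilinear (\<triangle>)"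
proof -
  have lin: "linear (\<lambda>z. y \<triangle> z)" for y :: 'a
  proof (rule linearI)
    show "y \<triangle> (z + z') = y \<triangle> z + y \<triangle> z'" for z z'
      by transfer (auto intro!: blinfun_eqI
          simp: sym_prod_blinfun.rep_eq blinfun.bilinear_simps algebra_simps)
    show "y \<triangle> (r *\<^sub>R z) = r *\<^sub>R (y \<triangle> z)" for r z
      by transfer (auto intro!: blinfun_eqI
          simp: sym_prod_blinfun.rep_eq blinfun.bilinear_simps algebra_simps)
  qed
  moreover have "(\<lambda>y. y \<triangle> z) = (\<lambda>y. z \<triangle> y)" for z :: 'a
    by (rule ext) (rule sym_prod_commute)
  ultimately show ?thesis by (simp add: bilinear_def)
qed

lemma span_sym_prod: "span {y \<triangle> z | y z. True} = (UNIV :: 'e::real_normed_vector sym_tensor set)"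
proof -
  have linR: "linear (Rep_sym_tensor :: 'e sym_tensor \<Rightarrow> _)"
    by (rule linearI) (simp_all add: plus_sym_tensor.rep_eq scaleR_sym_tensor.rep_eq)
  have "Rep_sym_tensor ` span {y \<triangle> z | y z. True}
      = span (Rep_sym_tensor ` {y \<triangle> z | y z :: 'e. True})"
    by (simp add: linear_span_image[OF linR])
  also have "Rep_sym_tensor ` {y \<triangle> z | y z :: 'e. True} = {sym_prod_blinfun y z | y z. True}"
    by (force simp: sym_prod.rep_eq image_iff)
  finally have range: "Rep_sym_tensor ` span {y \<triangle> z | y z. True}
      = span {sym_prod_blinfun y z | y z :: 'e. True}" .
  have "s \<in> span {y \<triangle> z | y z. True}" for s :: "'e sym_tensor"
  proof -
    have "Rep_sym_tensor s \<in> Rep_sym_tensor ` span {y \<triangle> z | y z. True}"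
      unfolding range by (rule Rep_sym_tensor)
    then show ?thesis by (auto simp: Rep_sym_tensor_inject)
  qed
  then show ?thesis by blast
qed

text \<open>The identification of symmetric bilinear maps on \<open>E \<times> E\<close> with linear maps on \<open>E \<Delta> E\<close>.
  The universal property, proved next, says that for symmetric bilinear \<open>b\<close> the description
  determines a unique map.\<close>

definition sym_lift ::
  "('e::real_normed_vector \<Rightarrow> 'e \<Rightarrow> 'f::real_vector) \<Rightarrow> 'e sym_tensor \<Rightarrow> 'f"
  where "sym_lift b = (THE l. linear l \<and> (\<forall>y z. l (y \<triangle> z) = b y z))"

lemma sym_tensor_universal:
  fixes b :: "'e::finite_dim_banach \<Rightarrow> 'e \<Rightarrow> 'f::real_vector"
  assumes b: "bilinear b" and sym: "\<And>y z. b y z = b z y"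
  shows "\<exists>!l. linear l \<and> (\<forall>y z. l (y \<triangle> z) = b y z)"
proof (rule ex_ex1I)
  obtain B0 :: "'e set" where B0: "finite B0" "span B0 = UNIV" using finite_dim by blast
  obtain B where B: "B \<subseteq> B0" "independent B" "B0 \<subseteq> span B"
    using maximal_independent_subset[of B0] by metis
  have fin: "finite B" using B B0 finite_subset by blast
  have spanB: "span B = UNIV"
    using B(3) B0(2) by (metis span_mono span_span top.extremum_uniqueI)
  define co where "co e = Blinfun (\<lambda>x. representation B x e)" for e
  have co: "blinfun_apply (co e) x = representation B x e" for e x
    unfolding co_def
    by (subst bounded_linear_Blinfun_apply)
      (auto intro!: linear_functional_bounded linearI
        simp: representation_add[OF B(2)] representation_scale[OF B(2)] spanB)
  have rep: "(\<Sum>e\<in>B. representation B x e *\<^sub>R e) = x" for x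
    using sum_representation_eq[OF B(2) _ fin] spanB by auto
  have expand: "b y z = (\<Sum>e\<in>B. \<Sum>e'\<in>B. (representation B y e * representation B z e') *\<^sub>R b e e')"
    for y z
  proof -
    have "b y z = b (\<Sum>e\<in>B. representation B y e *\<^sub>R e) (\<Sum>e'\<in>B. representation B z e' *\<^sub>R e')"
      by (simp only: rep)
    also have "\<dots> = (\<Sum>e\<in>B. \<Sum>e'\<in>B.
        b (representation B y e *\<^sub>R e) (representation B z e' *\<^sub>R e'))"
      by (simp add: bilinear_sum[OF b] sum.cartesian_product)
    finally show ?thesis
      by (simp add: bilinear_lmul[OF b] bilinear_rmul[OF b] mult.commute)
  qed
  define l where "l s = (\<Sum>e\<in>B. \<Sum>e'\<in>B.
      blinfun_apply (co e') (blinfun_apply (Rep_sym_tensor s) (co e)) *\<^sub>R b e e')" for s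
  have "linear l"
    by (rule linearI) (simp_all add: l_def plus_sym_tensor.rep_eq scaleR_sym_tensor.rep_eq
        blinfun.bilinear_simps scaleR_add_left sum.distrib scaleR_sum_right)
  moreover have "l (y \<triangle> z) = b y z" for y z
  proof -
    have "l (y \<triangle> z) = (\<Sum>e\<in>B. \<Sum>e'\<in>B. ((1/2) *
        (representation B y e * representation B z e'
          + representation B z e * representation B y e')) *\<^sub>R b e e')"
      by (simp add: l_def sym_prod.rep_eq sym_prod_blinfun.rep_eq blinfun.add_right
          blinfun.scaleR_right co)
    also have "\<dots> = (1/2) *\<^sub>R
        ((\<Sum>e\<in>B. \<Sum>e'\<in>B. (representation B y e * representation B z e') *\<^sub>R b e e')
        + (\<Sum>e\<in>B. \<Sum>e'\<in>B. (representation B z e * representation B y e') *\<^sub>R b e e'))"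
      by (simp only: distrib_left scaleR_add_left scaleR_add_right sum.distrib
          scaleR_sum_right scaleR_scaleR)
    also have "\<dots> = (1/2) *\<^sub>R (b y z + b z y)" by (simp only: expand[symmetric])
    also have "\<dots> = b y z" by (simp add: sym[of z y] scaleR_2[symmetric])
    finally show ?thesis .
  qed
  ultimately show "\<exists>l. linear l \<and> (\<forall>y z. l (y \<triangle> z) = b y z)" by blast
next
  fix l l' :: "'e sym_tensor \<Rightarrow> 'f"
  assume l: "linear l \<and> (\<forall>y z. l (y \<triangle> z) = b y z)"
    and l': "linear l' \<and> (\<forall>y z. l' (y \<triangle> z) = b y z)"
  show "l = l'"
  proof
    fix s :: "'e sym_tensor"
    show "l s = l' s"
      by (rule linear_eq_on_span[where B = "{y \<triangle> z | y z. True}"])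
        (use l l' span_sym_prod in auto)
  qed
qed

lemma sym_lift:
  fixes b :: "'e::finite_dim_banach \<Rightarrow> 'e \<Rightarrow> 'f::real_vector"
  assumes "bilinear b" "\<And>y z. b y z = b z y"
  shows linear_sym_lift: "linear (sym_lift b)"
    and sym_lift_sym_prod: "sym_lift b (y \<triangle> z) = b y z"
  using theI'[OF sym_tensor_universal[OF assms]] by (auto simp: sym_lift_def)

definition sym_map ::
  "('e::real_normed_vector \<Rightarrow> 'f::real_normed_vector) \<Rightarrow> 'e sym_tensor \<Rightarrow> 'f sym_tensor"
  where "sym_map L = sym_lift (\<lambda>y z. L y \<triangle> L z)"

section \<open>Smooth maps on open subsets of \<open>E\<close>\<close>

text \<open>The definitions below are meant for open \<open>S\<close> and finite-dimensional \<open>'e\<close>, where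
  continuity of all directional derivatives amounts to continuity of the derivative.\<close>

primrec Ck_on ::
  "nat \<Rightarrow> 'e::real_normed_vector set \<Rightarrow> ('e \<Rightarrow> 'f::real_normed_vector) \<Rightarrow> bool"
  where
    "Ck_on 0 S f \<longleftrightarrow> continuous_on S f"
  | "Ck_on (Suc n) S f \<longleftrightarrow>
      (\<forall>u\<in>S. f differentiable (at u)) \<and> (\<forall>v. Ck_on n S (\<lambda>u. frechet_derivative f (at u) v))"

definition smooth_on ::
  "'e::real_normed_vector set \<Rightarrow> ('e \<Rightarrow> 'f::real_normed_vector) \<Rightarrow> bool"
  where "smooth_on S f \<longleftrightarrow> (\<forall>n. Ck_on n S f)"

abbreviation D1 :: "('e::real_normed_vector \<Rightarrow> 'f::real_normed_vector) \<Rightarrow> 'e \<Rightarrow> 'e \<Rightarrow> 'f"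
  where "D1 f u x \<equiv> frechet_derivative f (at u) x"

definition D2 :: "('e::real_normed_vector \<Rightarrow> 'f::real_normed_vector) \<Rightarrow> 'e \<Rightarrow> 'e \<Rightarrow> 'e \<Rightarrow> 'f"
  where "D2 f u x y = D1 (\<lambda>w. D1 f w y) u x"

definition D3 :: "('e::real_normed_vector \<Rightarrow> 'f::real_normed_vector) \<Rightarrow> 'e \<Rightarrow> 'e \<Rightarrow> 'e \<Rightarrow> 'e \<Rightarrow> 'f"
  where "D3 f u x y z = D1 (\<lambda>w. D2 f w y z) u x"

section \<open>Smooth manifolds\<close>

text \<open>The manifold is a whole type \<open>'m\<close>. A chart \<open>(U, \<phi>)\<close> carries a total function \<open>\<phi>\<close>
  whose values outside \<open>U\<close> are irrelevant.\<close>

type_synonym ('m, 'e) chart = "'m set \<times> ('m \<Rightarrow> 'e)"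

abbreviation chart_dom :: "('m, 'e) chart \<Rightarrow> 'm set"
  where "chart_dom \<equiv> fst"

abbreviation chart_map :: "('m, 'e) chart \<Rightarrow> 'm \<Rightarrow> 'e"
  where "chart_map \<equiv> snd"

definition chart_im :: "('m, 'e) chart \<Rightarrow> 'e set"
  where "chart_im c = chart_map c ` chart_dom c"

definition param :: "('m, 'e) chart \<Rightarrow> 'e \<Rightarrow> 'm"
  where "param c = inv_into (chart_dom c) (chart_map c)"

definition is_chart :: "('m::topological_space, 'e::real_normed_vector) chart \<Rightarrow> bool"
  where "is_chart c \<longleftrightarrow>
    open (chart_dom c) \<and> open (chart_im c) \<and>
    homeomorphism (chart_dom c) (chart_im c) (chart_map c) (param c)"

definition transition :: "('m, 'e) chart \<Rightarrow> ('m, 'e) chart \<Rightarrow> 'e \<Rightarrow> 'e"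
  where "transition c d = chart_map d \<circ> param c"

definition smoothly_compatible ::
  "('m, 'e::real_normed_vector) chart \<Rightarrow> ('m, 'e) chart \<Rightarrow> bool"
  where "smoothly_compatible c d \<longleftrightarrow>
    smooth_on (chart_map c ` (chart_dom c \<inter> chart_dom d)) (transition c d) \<and>
    smooth_on (chart_map d ` (chart_dom c \<inter> chart_dom d)) (transition d c)"

text \<open>A smooth structure is a maximal atlas, so that ``chart'' means ``member of \<open>A\<close>''.\<close>

definition smooth_structure ::
  "('m::topological_space, 'e::real_normed_vector) chart set \<Rightarrow> bool"
  where "smooth_structure A \<longleftrightarrow>
    (\<forall>c\<in>A. is_chart c) \<and>
    (\<Union>c\<in>A. chart_dom c) = UNIV \<and>
    (\<forall>c\<in>A. \<forall>d\<in>A. smoothly_compatible c d) \<and>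
    (\<forall>c. is_chart c \<and> (\<forall>d\<in>A. smoothly_compatible c d) \<longrightarrow> c \<in> A)"

definition paracompact_space :: "'m topology \<Rightarrow> bool"
  where "paracompact_space T \<longleftrightarrow>
    (\<forall>\<U>. (\<forall>U\<in>\<U>. openin T U) \<and> \<Union>\<U> = topspace T \<longrightarrow>
      (\<exists>\<V>. (\<forall>V\<in>\<V>. openin T V) \<and> \<Union>\<V> = topspace T \<and>
        (\<forall>V\<in>\<V>. \<exists>U\<in>\<U>. V \<subseteq> U) \<and> locally_finite_in T \<V>))"

text \<open>Hausdorffness is the type class \<open>t2_space\<close>.\<close>

definition smooth_manifold :: "('m::t2_space, 'e::finite_dim_banach) chart set \<Rightarrow> bool"
  where "smooth_manifold A \<longleftrightarrow>
    paracompact_space (euclidean :: 'm topology) \<and> smooth_structure A"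

definition fun_rep :: "('m, 'e) chart \<Rightarrow> ('m \<Rightarrow> 'f) \<Rightarrow> 'e \<Rightarrow> 'f"
  where "fun_rep c f = f \<circ> param c"

definition smooth_functions :: "('m, 'e::real_normed_vector) chart set \<Rightarrow> ('m \<Rightarrow> real) set"
  where "smooth_functions A = {f. \<forall>c\<in>A. smooth_on (chart_im c) (fun_rep c f)}"

section \<open>Vector bundles\<close>

text \<open>A bundle with fibre \<open>'f\<close> is given by its chart changes: \<open>g c d u\<close> maps the
  representative in the chart \<open>c\<close> of an element over the point with coordinate \<open>u\<close> in \<open>c\<close> to
  the representative of the same element in the chart \<open>d\<close>. A bundle element over \<open>m\<close> is the family
  of its representatives in all charts at \<open>m\<close>; the family is \<open>0\<close> on all other pairs \<open>(U, \<phi>)\<close>,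
  so that equality of elements is equality of families.\<close>

type_synonym ('m, 'e, 'f) bundle_element = "('m, 'e) chart \<Rightarrow> 'f"

type_synonym ('m, 'e, 'f) cocycle = "('m, 'e) chart \<Rightarrow> ('m, 'e) chart \<Rightarrow> 'e \<Rightarrow> 'f \<Rightarrow> 'f"

definition fibre ::
  "('m, 'e) chart set \<Rightarrow> ('m, 'e, 'f::real_vector) cocycle \<Rightarrow> 'm \<Rightarrow>
    ('m, 'e, 'f) bundle_element set"
  where "fibre A g m = {\<xi>.
    (\<forall>c. \<not> (c \<in> A \<and> m \<in> chart_dom c) \<longrightarrow> \<xi> c = 0) \<and>
    (\<forall>c\<in>A. \<forall>d\<in>A. m \<in> chart_dom c \<inter> chart_dom d \<longrightarrow> \<xi> d = g c d (chart_map c m) (\<xi> c))}"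

definition section_rep ::
  "('m, 'e) chart \<Rightarrow> ('m \<Rightarrow> ('m, 'e, 'f) bundle_element) \<Rightarrow> 'e \<Rightarrow> 'f"
  where "section_rep c \<tau> u = \<tau> (param c u) c"

definition smooth_sections ::
  "('m, 'e::real_normed_vector) chart set \<Rightarrow> ('m, 'e, 'f::real_normed_vector) cocycle \<Rightarrow>
    ('m \<Rightarrow> ('m, 'e, 'f) bundle_element) set"
  where "smooth_sections A g = {\<tau>.
    (\<forall>m. \<tau> m \<in> fibre A g m) \<and> (\<forall>c\<in>A. smooth_on (chart_im c) (section_rep c \<tau>))}"

definition TM :: "('m, 'e::real_normed_vector, 'e) cocycle"
  where "TM c d u e = D1 (transition c d) u e"

definition T2M :: "('m, 'e::real_normed_vector, 'e \<times> 'e sym_tensor) cocycle"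
  where "T2M c d u = (\<lambda>(e, s).
    (D1 (transition c d) u e + sym_lift (D2 (transition c d) u) s,
     sym_map (D1 (transition c d) u) s))"

abbreviation vector_fields ::
  "('m, 'e::real_normed_vector) chart set \<Rightarrow> ('m \<Rightarrow> ('m, 'e, 'e) bundle_element) set"
  where "vector_fields A \<equiv> smooth_sections A TM"

text \<open>\<open>X \<cdot> f\<close>, the common value in all charts of \<open>Df\<^sub>\<phi> \<cdot> X\<^sub>\<phi>\<close>.\<close>

definition lie_derivative ::
  "('m, 'e::real_normed_vector) chart set \<Rightarrow> ('m \<Rightarrow> ('m, 'e, 'e) bundle_element) \<Rightarrow>
    ('m \<Rightarrow> real) \<Rightarrow> 'm \<Rightarrow> real"
  where "lie_derivative A X f m =
    (THE r. \<forall>c\<in>A. m \<in> chart_dom c \<longrightarrow> r = D1 (fun_rep c f) (chart_map c m) (X m c))"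

section \<open>Koszul connections and their Christoffel symbols\<close>

definition section_add ::
  "('m \<Rightarrow> ('m, 'e, 'f::real_vector) bundle_element) \<Rightarrow> ('m \<Rightarrow> ('m, 'e, 'f) bundle_element) \<Rightarrow>
    'm \<Rightarrow> ('m, 'e, 'f) bundle_element"
  where "section_add \<sigma> \<tau> m c = \<sigma> m c + \<tau> m c"

definition section_scale ::
  "('m \<Rightarrow> real) \<Rightarrow> ('m \<Rightarrow> ('m, 'e, 'f::real_vector) bundle_element) \<Rightarrow>
    'm \<Rightarrow> ('m, 'e, 'f) bundle_element"
  where "section_scale f \<tau> m c = f m *\<^sub>R \<tau> m c"

type_synonym ('m, 'e, 'f) connection =
  "('m \<Rightarrow> ('m, 'e, 'e) bundle_element) \<Rightarrow> ('m \<Rightarrow> ('m, 'e, 'f) bundle_element) \<Rightarrow>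
    'm \<Rightarrow> ('m, 'e, 'f) bundle_element"

definition koszul_connection ::
  "('m, 'e::real_normed_vector) chart set \<Rightarrow> ('m, 'e, 'f::real_normed_vector) cocycle \<Rightarrow>
    ('m, 'e, 'f) connection \<Rightarrow> bool"
  where "koszul_connection A g N \<longleftrightarrow>
    (\<forall>X\<in>vector_fields A. \<forall>\<tau>\<in>smooth_sections A g.
      N X \<tau> \<in> smooth_sections A g \<and>
      (\<forall>X'\<in>vector_fields A. N (section_add X X') \<tau> = section_add (N X \<tau>) (N X' \<tau>)) \<and>
      (\<forall>\<tau>'\<in>smooth_sections A g. N X (section_add \<tau> \<tau>') = section_add (N X \<tau>) (N X \<tau>')) \<and>
      (\<forall>f\<in>smooth_functions A.
        N (section_scale f X) \<tau> = section_scale f (N X \<tau>) \<and>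
        N X (section_scale f \<tau>) =
          section_add (section_scale (lie_derivative A X f) \<tau>) (section_scale f (N X \<tau>))))"

text \<open>Note the sign convention: the Christoffel symbol is subtracted.\<close>

definition christoffel_symbol ::
  "('m, 'e::real_normed_vector) chart set \<Rightarrow> ('m, 'e, 'f::real_normed_vector) cocycle \<Rightarrow>
    ('m, 'e, 'f) connection \<Rightarrow> ('m, 'e) chart \<Rightarrow> ('e \<Rightarrow> 'e \<Rightarrow> 'f \<Rightarrow> 'f) \<Rightarrow> bool"
  where "christoffel_symbol A g N c \<Gamma> \<longleftrightarrow>
    (\<forall>u\<in>chart_im c. bilinear (\<Gamma> u)) \<and>
    (\<forall>X\<in>vector_fields A. \<forall>\<tau>\<in>smooth_sections A g. \<forall>u\<in>chart_im c.
      section_rep c (N X \<tau>) u =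
        D1 (section_rep c \<tau>) u (section_rep c X u) - \<Gamma> u (section_rep c X u) (section_rep c \<tau> u))"

section \<open>Special second-order connections\<close>

definition special_christoffel_symbols ::
  "('m, 'e::real_normed_vector) chart set \<Rightarrow> ('m, 'e, 'e \<times> 'e sym_tensor) connection \<Rightarrow>
    ('m, 'e) chart \<Rightarrow> ('e \<Rightarrow> 'e \<Rightarrow> 'e sym_tensor \<Rightarrow> 'e) \<Rightarrow>
    ('e \<Rightarrow> 'e \<Rightarrow> 'e sym_tensor \<Rightarrow> 'e sym_tensor) \<Rightarrow> bool"
  where "special_christoffel_symbols A N c R C \<longleftrightarrow>
    christoffel_symbol A T2M N c (\<lambda>u x (v, s). (R u x s, - (x \<triangle> v) + C u x s)) \<and>
    (\<forall>u\<in>chart_im c. bilinear (R u) \<and> bilinear (C u)) \<and>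
    (\<forall>x s. smooth_on (chart_im c) (\<lambda>u. R u x s) \<and> smooth_on (chart_im c) (\<lambda>u. C u x s))"

definition special_second_order_connection ::
  "('m, 'e::real_normed_vector) chart set \<Rightarrow> ('m, 'e, 'e \<times> 'e sym_tensor) connection \<Rightarrow> bool"
  where "special_second_order_connection A N \<longleftrightarrow>
    koszul_connection A T2M N \<and> (\<forall>c\<in>A. \<exists>R C. special_christoffel_symbols A N c R C)"

definition nabla2 ::
  "('m, 'e::real_normed_vector) chart set \<Rightarrow> ('m, 'e, 'e) connection \<Rightarrow> ('m \<Rightarrow> real) \<Rightarrow>
    ('m \<Rightarrow> ('m, 'e, 'e) bundle_element) \<Rightarrow> ('m \<Rightarrow> ('m, 'e, 'e) bundle_element) \<Rightarrow> 'm \<Rightarrow> real"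
  where "nabla2 A N f Y Z m =
    lie_derivative A Y (lie_derivative A Z f) m - lie_derivative A (N Y Z) f m"

definition nabla3 ::
  "('m, 'e::real_normed_vector) chart set \<Rightarrow> ('m, 'e, 'e) connection \<Rightarrow> ('m \<Rightarrow> real) \<Rightarrow>
    ('m \<Rightarrow> ('m, 'e, 'e) bundle_element) \<Rightarrow> ('m \<Rightarrow> ('m, 'e, 'e) bundle_element) \<Rightarrow>
    ('m \<Rightarrow> ('m, 'e, 'e) bundle_element) \<Rightarrow> 'm \<Rightarrow> real"
  where "nabla3 A N f X Y Z m =
    lie_derivative A X (nabla2 A N f Y Z) m - nabla2 A N f (N X Y) Z m - nabla2 A N f Y (N X Z) m"

text \<open>Since \<open>y \<triangle> z\<close> is symmetric, such an \<open>Nt\<close> can exist only if \<open>\<nabla>\<^sup>3f(X,Y,Z)\<close> is symmetric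
  in \<open>Y\<close> and \<open>Z\<close>.\<close>

definition induced_connection ::
  "('m, 'e::real_normed_vector) chart set \<Rightarrow> ('m, 'e, 'e) connection \<Rightarrow>
    ('m, 'e, 'e \<times> 'e sym_tensor) connection \<Rightarrow> bool"
  where "induced_connection A N Nt \<longleftrightarrow>
    special_second_order_connection A Nt \<and>
    (\<forall>c\<in>A. \<forall>R C. special_christoffel_symbols A Nt c R C \<longrightarrow>
      (\<forall>f\<in>smooth_functions A.
        \<forall>X\<in>vector_fields A. \<forall>Y\<in>vector_fields A. \<forall>Z\<in>vector_fields A. \<forall>u\<in>chart_im c.
        (let x = section_rep c X u; y = section_rep c Y u; z = section_rep c Z u in
          fun_rep c (nabla3 A N f X Y Z) u =
            D3 (fun_rep c f) u x y z +
            sym_lift (D2 (fun_rep c f) u) (C u x (y \<triangle> z)) +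
            D1 (fun_rep c f) u (R u x (y \<triangle> z)))))"

end

theory Submission
  imports Defs "HOL-Real_Asymp.Real_Asymp"
begin

text \<open>Expanding \<open>\<nabla>\<^sup>3f\<close> in the chart expresses it through \<open>D\<^sup>3f\<^sub>\<phi>\<close>, \<open>D\<^sup>2f\<^sub>\<phi>\<close> and \<open>Df\<^sub>\<phi>\<close>, with the
  claimed right-hand sides as coefficients. The Christoffel symbols of the induced connection give
  another such expression, so the two can be identified as soon as smooth functions on \<open>M\<close> realise
  enough \<open>2\<close>-jets at a given point: the jets \<open>(Df, D\<^sup>2f)\<close> proportional to \<open>(k, 0)\<close> and
  \<open>(0, l \<otimes> k + k \<otimes> l)\<close> for linear functionals \<open>k\<close>, \<open>l\<close> separate the points of \<open>E\<close> and of \<open>E \<Delta> E\<close>.\<close>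

section \<open>Differential calculus in finite dimension\<close>

text \<open>Coordinate functionals as bounded maps, so that they can be differentiated. Expanding a
  linear map through them reduces calculus with operator-valued maps to finite sums of scalars times
  vectors.\<close>

lemma finite_dim_coordinates:
  obtains B and co :: "'e::finite_dim_banach \<Rightarrow> 'e \<Rightarrow>\<^sub>L real"
  where "finite B" "\<And>x. (\<Sum>b\<in>B. co b x *\<^sub>R b) = x"
proof -
  obtain B0 :: "'e set" where B0: "finite B0" "span B0 = UNIV" using finite_dim by blast
  obtain B where B: "B \<subseteq> B0" "independent B" "B0 \<subseteq> span B"
    using maximal_independent_subset[of B0] by metis
  have fin: "finite B" using B B0 finite_subset by blast
  have spanB: "span B = UNIV"
    using B(3) B0(2) by (metis span_mono span_span top.extremum_uniqueI)
  have lin: "bounded_linear (\<lambda>x. representation B x b)" for b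
    by (auto intro!: linear_functional_bounded linearI
        simp: representation_add[OF B(2)] representation_scale[OF B(2)] spanB)
  show thesis
    by (rule that[of B "\<lambda>b. Blinfun (\<lambda>x. representation B x b)"])
      (use sum_representation_eq[OF B(2) _ fin] spanB in
        \<open>auto simp: fin bounded_linear_Blinfun_apply[OF lin]\<close>)
qed

lemma linear_coordinates:
  assumes "linear f" "\<And>x. (\<Sum>b\<in>B. blinfun_apply (co b) x *\<^sub>R b) = x"
  shows "f x = (\<Sum>b\<in>B. blinfun_apply (co b) x *\<^sub>R f b)"
proof -
  have "f x = f (\<Sum>b\<in>B. co b x *\<^sub>R b)" by (simp only: assms(2))
  then show ?thesis by (simp only: linear_sum[OF assms(1)] linear_cmul[OF assms(1)])
qed

lemma has_derivative_D1:
  "f differentiable (at u) \<Longrightarrow> (f has_derivative D1 f u) (at u)"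
  using frechet_derivative_works by blast

lemma D1_eq: "(f has_derivative f') (at u) \<Longrightarrow> D1 f u x = f' x"
  by (metis frechet_derivative_at)

lemma linear_D1: "f differentiable (at u) \<Longrightarrow> linear (D1 f u)"
  by (simp add: linear_frechet_derivative)

lemma D1_cong:
  assumes "open S" "u \<in> S" "\<And>w. w \<in> S \<Longrightarrow> f w = g w"
  shows "frechet_derivative f (at u) = frechet_derivative g (at u)"
proof -
  \<comment> \<open>\<open>frechet_derivative\<close> is a choice of some derivative, so equality of
    the two predicates gives equality of the chosen maps even at points without a
    derivative.\<close>
  have "(f has_derivative f') (at u) = (g has_derivative f') (at u)" for f'
    using assms has_derivative_transform_within_open[of f f' u UNIV S g]
      has_derivative_transform_within_open[of g f' u UNIV S f] by auto
  then show ?thesis by (simp add: frechet_derivative_def)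
qed

lemma differentiable_cong:
  assumes "open S" "u \<in> S" "\<And>w. w \<in> S \<Longrightarrow> f w = g w" "f differentiable (at u)"
  shows "g differentiable (at u)"
  using assms has_derivative_transform_within_open[of f _ u UNIV S g]
  unfolding differentiable_def by metis

text \<open>A product rule for evaluation, with \<open>B\<close> known only vector by vector. In
  coordinates of \<open>Z w\<close> the map is a finite sum of scalar functions times the functions
  \<open>B w b\<close>, to which the usual product rule applies.\<close>

lemma has_derivative_linear_family:
  fixes Z :: "'a::real_normed_vector \<Rightarrow> 'e::finite_dim_banach"
    and B :: "'a \<Rightarrow> 'e \<Rightarrow> 'f::real_normed_vector"
  assumes S: "open S" "u \<in> S" and lin: "\<And>w. w \<in> S \<Longrightarrow> linear (B w)"
    and B: "\<And>e. (\<lambda>w. B w e) differentiable (at u)" and Z: "Z differentiable (at u)"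
  shows "((\<lambda>w. B w (Z w)) has_derivative
    (\<lambda>x. D1 (\<lambda>w. B w (Z u)) u x + B u (D1 Z u x))) (at u)"
proof -
  obtain I and co :: "'e \<Rightarrow> 'e \<Rightarrow>\<^sub>L real"
    where co: "finite I" "\<And>x. (\<Sum>b\<in>I. co b x *\<^sub>R b) = x"
    using finite_dim_coordinates by blast
  have ex: "B w e = (\<Sum>b\<in>I. co b e *\<^sub>R B w b)" if "w \<in> S" for w e
    by (rule linear_coordinates[OF lin[OF that] co(2)])
  have "((\<lambda>w. \<Sum>b\<in>I. co b (Z u) *\<^sub>R B w b) has_derivative
      (\<lambda>x. \<Sum>b\<in>I. co b (Z u) *\<^sub>R D1 (\<lambda>w. B w b) u x)) (at u)"
    by (intro has_derivative_sum has_derivative_scaleR_right has_derivative_D1[OF B])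
  then have "((\<lambda>w. B w (Z u)) has_derivative
      (\<lambda>x. \<Sum>b\<in>I. co b (Z u) *\<^sub>R D1 (\<lambda>w. B w b) u x)) (at u)"
    by (rule has_derivative_transform_within_open[OF _ S]) (rule ex[symmetric])
  note D = D1_eq[OF this]
  have "((\<lambda>w. \<Sum>b\<in>I. co b (Z w) *\<^sub>R B w b) has_derivative
      (\<lambda>x. \<Sum>b\<in>I. co b (Z u) *\<^sub>R D1 (\<lambda>w. B w b) u x + co b (D1 Z u x) *\<^sub>R B u b)) (at u)"
    by (intro has_derivative_sum has_derivative_scaleR has_derivative_D1[OF B]
        bounded_linear.has_derivative[OF blinfun.bounded_linear_right] has_derivative_D1[OF Z])
  then have "((\<lambda>w. \<Sum>b\<in>I. co b (Z w) *\<^sub>R B w b) has_derivative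
      (\<lambda>x. D1 (\<lambda>w. B w (Z u)) u x + B u (D1 Z u x))) (at u)"
    by (simp only: D sum.distrib ex[OF S(2), symmetric])
  then show ?thesis
    by (rule has_derivative_transform_within_open[OF _ S]) (rule ex[symmetric])
qed

section \<open>Closure properties of smooth maps\<close>

lemma Ck_on_cong:
  assumes "open S" "Ck_on n S f" "\<And>w. w \<in> S \<Longrightarrow> f w = g w"
  shows "Ck_on n S g"
  using assms(2,3)
proof (induction n arbitrary: f g)
  case 0
  then show ?case by (simp cong: continuous_on_cong)
next
  case (Suc n)
  have "g differentiable (at u)" if "u \<in> S" for u
    using differentiable_cong[OF \<open>open S\<close> that Suc.prems(2)] Suc.prems(1) that by simp
  moreover have "Ck_on n S (\<lambda>u. D1 g u v)" for v
  proof (rule Suc.IH)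
    show "Ck_on n S (\<lambda>u. D1 f u v)" using Suc.prems(1) by simp
    show "D1 f u v = D1 g u v" if "u \<in> S" for u
      by (rule fun_cong[OF D1_cong[OF \<open>open S\<close> that Suc.prems(2)]])
  qed
  ultimately show ?case by simp
qed

text \<open>Allows an explicit formula \<open>f'\<close> in place of the chosen
  \<open>frechet_derivative\<close>: the two agree on the open set \<open>S\<close>, and
  \<open>Ck_on\<close> depends only on the values there.\<close>

lemma Ck_on_SucI:
  assumes "open S" "\<And>u. u \<in> S \<Longrightarrow> (f has_derivative f' u) (at u)"
    "\<And>v. Ck_on n S (\<lambda>u. f' u v)"
  shows "Ck_on (Suc n) S f"
proof -
  have "Ck_on n S (\<lambda>u. D1 f u v)" for v
    by (rule Ck_on_cong[OF assms(1) assms(3)[of v]]) (rule D1_eq[OF assms(2), symmetric])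
  then show ?thesis using assms(2) by (auto simp: differentiable_def)
qed

lemma Ck_on_SucD:
  assumes "Ck_on (Suc n) S f"
  shows "u \<in> S \<Longrightarrow> (f has_derivative D1 f u) (at u)" "Ck_on n S (\<lambda>u. D1 f u v)"
  using assms by (auto intro: has_derivative_D1)

lemma Ck_on_Suc_imp: "Ck_on (Suc n) S f \<Longrightarrow> Ck_on n S f"
proof (induction n arbitrary: f)
  case 0
  then show ?case
    by (auto intro!: continuous_at_imp_continuous_on differentiable_imp_continuous_within)
next
  case (Suc n)
  have "Ck_on n S (\<lambda>u. D1 f u v)" for v
    by (rule Suc.IH[OF Ck_on_SucD(2)[OF Suc.prems]])
  then show ?case using Suc.prems by simp
qed

lemma Ck_on_const: "Ck_on n S (\<lambda>_. a)"
  by (induction n arbitrary: a) simp_all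

lemma Ck_on_bounded_linear:
  assumes "open S" "bounded_linear L"
  shows "Ck_on n S L"
proof (cases n)
  case 0
  then show ?thesis using assms by (simp add: linear_continuous_on)
next
  case (Suc m)
  show ?thesis unfolding Suc
    by (rule Ck_on_SucI[OF assms(1) bounded_linear_imp_has_derivative[OF assms(2)] Ck_on_const])
qed

lemma Ck_on_add:
  assumes "open S" "Ck_on n S f" "Ck_on n S g"
  shows "Ck_on n S (\<lambda>u. f u + g u)"
  using assms(2,3)
proof (induction n arbitrary: f g)
  case 0
  then show ?case by (simp add: continuous_on_add)
next
  case (Suc n)
  show ?case
    by (rule Ck_on_SucI[OF \<open>open S\<close> has_derivative_add[OF Ck_on_SucD(1)[OF Suc.prems(1)]
          Ck_on_SucD(1)[OF Suc.prems(2)]] Suc.IH[OF Ck_on_SucD(2)[OF Suc.prems(1)]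
          Ck_on_SucD(2)[OF Suc.prems(2)]]])
qed

lemma Ck_on_sum:
  assumes "open S" "\<And>i. i \<in> I \<Longrightarrow> Ck_on n S (f i)"
  shows "Ck_on n S (\<lambda>u. \<Sum>i\<in>I. f i u)"
  using assms(2)
proof (induction I rule: infinite_finite_induct)
  case (insert i I)
  then have "Ck_on n S (\<lambda>u. f i u + (\<Sum>j\<in>I. f j u))"
    by (intro Ck_on_add[OF \<open>open S\<close>]) auto
  with insert show ?case by simp
qed (simp_all add: Ck_on_const)

lemma Ck_on_scaleR:
  assumes "open S" "Ck_on n S f" "Ck_on n S g"
  shows "Ck_on n S (\<lambda>u. f u *\<^sub>R g u)"
  using assms(2,3)
proof (induction n arbitrary: f g)
  case 0
  then show ?case by (simp add: continuous_on_scaleR)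
next
  case (Suc n)
  \<comment> \<open>The product rule leaves one factor undifferentiated, whose order must be lowered
    from \<open>Suc n\<close> to \<open>n\<close> before the induction hypothesis applies.\<close>
  have D: "Ck_on n S (\<lambda>u. f u *\<^sub>R D1 g u v + D1 f u v *\<^sub>R g u)" for v
    using Suc.IH[OF Ck_on_Suc_imp[OF Suc.prems(1)] Ck_on_SucD(2)[OF Suc.prems(2)]]
      Suc.IH[OF Ck_on_SucD(2)[OF Suc.prems(1)] Ck_on_Suc_imp[OF Suc.prems(2)]]
    by (rule Ck_on_add[OF \<open>open S\<close>])
  show ?case
    by (rule Ck_on_SucI[OF \<open>open S\<close> has_derivative_scaleR[OF Ck_on_SucD(1)[OF Suc.prems(1)]
          Ck_on_SucD(1)[OF Suc.prems(2)]] D])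
qed

text \<open>In the chain rule the direction \<open>D1 T u v\<close> fed to \<open>D1 F (T u)\<close>
  varies with \<open>u\<close>, whereas the induction hypothesis covers fixed directions. Expanding
  in coordinates leaves the fixed directions \<open>b\<close>, with scalar coefficients
  \<open>co b (D1 T u v)\<close>.\<close>

lemma Ck_on_compose:
  fixes T :: "'a::real_normed_vector \<Rightarrow> 'e::finite_dim_banach"
  assumes "open S" "open S'" "T ` S \<subseteq> S'" "Ck_on n S T" "Ck_on n S' F"
  shows "Ck_on n S (\<lambda>u. F (T u))"
  using assms(4,5)
proof (induction n arbitrary: F)
  case 0
  then show ?case using assms(3) by (simp add: continuous_on_compose2)
next
  case (Suc n)
  obtain I and co :: "'e \<Rightarrow> 'e \<Rightarrow>\<^sub>L real"
    where co: "finite I" "\<And>x. (\<Sum>b\<in>I. co b x *\<^sub>R b) = x"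
    using finite_dim_coordinates by blast
  have T: "u \<in> S \<Longrightarrow> T u \<in> S'" for u using assms(3) by auto
  have deriv: "((\<lambda>u. F (T u)) has_derivative
      (\<lambda>v. \<Sum>b\<in>I. co b (D1 T u v) *\<^sub>R D1 F (T u) b)) (at u)" if "u \<in> S" for u
  proof -
    note F' = Ck_on_SucD(1)[OF Suc.prems(2) T[OF that]]
    show ?thesis
      using has_derivative_compose[OF Ck_on_SucD(1)[OF Suc.prems(1) that] F']
      by (simp only: linear_coordinates[OF has_derivative_linear[OF F'] co(2), symmetric])
  qed
  \<comment> \<open>The outer induction only composes with \<open>T\<close>; composing the
    functional \<open>co b\<close> with another map takes an induction of its own, in which
    \<open>co b\<close> commutes with the derivative.\<close>
  have "Ck_on n S (\<lambda>u. co b (D1 T u v))" for b v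
  proof -
    have "Ck_on m S g \<Longrightarrow> Ck_on m S (\<lambda>u. co b (g u))" for m and g :: "'a \<Rightarrow> 'e"
    proof (induction m arbitrary: g)
      case 0
      then show ?case by (auto intro: continuous_intros)
    next
      case (Suc m)
      show ?case
        by (rule Ck_on_SucI[OF \<open>open S\<close>
              bounded_linear.has_derivative[OF blinfun.bounded_linear_right
                Ck_on_SucD(1)[OF Suc.prems]]])
          (auto intro: Suc.IH Ck_on_SucD(2)[OF Suc.prems])
    qed
    then show ?thesis using Ck_on_SucD(2)[OF Suc.prems(1)] by blast
  qed
  moreover have "Ck_on n S (\<lambda>u. D1 F (T u) b)" for b
    by (rule Suc.IH[OF Ck_on_Suc_imp[OF Suc.prems(1)] Ck_on_SucD(2)[OF Suc.prems(2)]])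
  ultimately show ?case
    by (intro Ck_on_SucI[OF \<open>open S\<close> deriv] Ck_on_sum Ck_on_scaleR \<open>open S\<close>)
qed

text \<open>For gluing functions defined by cases on a manifold. The neighbourhood found at
  \<open>u\<close> serves all directional derivatives at once.\<close>

lemma Ck_on_local:
  assumes "\<And>u. u \<in> S \<Longrightarrow> \<exists>U. open U \<and> u \<in> U \<and> Ck_on n U f"
  shows "Ck_on n S f"
  using assms
proof (induction n arbitrary: f)
  case 0
  have "isCont f u" if u: "u \<in> S" for u
  proof -
    obtain U where U: "open U" "u \<in> U" "continuous_on U f" using 0[OF u] by auto
    then show ?thesis by (simp add: continuous_on_eq_continuous_at)
  qed
  then show ?case by (simp add: continuous_at_imp_continuous_on)
next
  case (Suc n)
  have U: "\<exists>U. open U \<and> u \<in> U \<and> f differentiable (at u) \<and> (\<forall>v. Ck_on n U (\<lambda>u. D1 f u v))"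
    if u: "u \<in> S" for u
  proof -
    obtain U where "open U" "u \<in> U" "Ck_on (Suc n) U f" using Suc.prems[OF u] by blast
    then show ?thesis by (intro exI[of _ U]) simp
  qed
  have "Ck_on n S (\<lambda>u. D1 f u v)" for v
    by (rule Suc.IH) (use U in blast)
  moreover have "f differentiable (at u)" if "u \<in> S" for u
    using U[OF that] by blast
  ultimately show ?case by simp
qed

lemma smooth_onD:
  assumes "smooth_on S f"
  shows "u \<in> S \<Longrightarrow> f differentiable (at u)" "smooth_on S (\<lambda>w. D1 f w v)"
proof -
  have *: "Ck_on (Suc n) S f" for n using assms unfolding smooth_on_def by blast
  show "u \<in> S \<Longrightarrow> f differentiable (at u)" using *[of 0] by simp
  show "smooth_on S (\<lambda>w. D1 f w v)"
    unfolding smooth_on_def by (intro allI Ck_on_SucD(2)[OF *])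
qed

lemma smooth_on_subset:
  assumes "smooth_on S f" "T \<subseteq> S" shows "smooth_on T f"
proof -
  have "Ck_on n S f \<Longrightarrow> Ck_on n T f" for n
  proof (induction n arbitrary: f)
    case 0
    then show ?case using continuous_on_subset[OF _ assms(2)] by simp
  next
    case (Suc n)
    then show ?case using assms(2) Suc.IH[OF Ck_on_SucD(2)[OF Suc.prems]] by auto
  qed
  then show ?thesis using assms(1) unfolding smooth_on_def by blast
qed

lemma smooth_on_diff_const:
  assumes "open S" shows "smooth_on S (\<lambda>w. blinfun_apply l (w - u))"
proof -
  have "Ck_on n S (\<lambda>w. l w + - l u)" for n
    by (intro Ck_on_add Ck_on_bounded_linear Ck_on_const assms blinfun.bounded_linear_right)
  then show ?thesis by (simp add: smooth_on_def blinfun.diff_right)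
qed

lemma smooth_on_mult:
  fixes f g :: "'e::real_normed_vector \<Rightarrow> real"
  shows "open S \<Longrightarrow> smooth_on S f \<Longrightarrow> smooth_on S g \<Longrightarrow> smooth_on S (\<lambda>u. f u * g u)"
  unfolding smooth_on_def using Ck_on_scaleR[of S _ f g] by auto

section \<open>A bump function\<close>

text \<open>The derivatives of \<open>exp (- 1/t)\<close> are linear combinations of the functions
  \<open>exp (- 1/t) / t\<^sup>k\<close>, whence the extra parameter \<open>k\<close>.\<close>

definition exp_bump :: "nat \<Rightarrow> real \<Rightarrow> real"
  where "exp_bump k t = (if t > 0 then exp (- inverse t) * inverse t ^ k else 0)"

lemma exp_bump_tendsto: "(exp_bump k \<longlongrightarrow> 0) (at 0)"
proof -
  have "((\<lambda>t. exp (- inverse t) * inverse t ^ k) \<longlongrightarrow> (0::real)) (at_right 0)" by real_asymp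
  then have "(exp_bump k \<longlongrightarrow> 0) (at_right 0)"
    by (rule Lim_transform_eventually)
      (auto simp: eventually_at_filter exp_bump_def)
  moreover have "(exp_bump k \<longlongrightarrow> 0) (at_left 0)"
    by (rule Lim_transform_eventually[OF tendsto_const])
      (auto simp: eventually_at_filter exp_bump_def)
  ultimately show ?thesis by (simp add: filterlim_split_at)
qed

lemma exp_bump_deriv:
  "(exp_bump k has_real_derivative exp_bump (k + 2) t - real k * exp_bump (Suc k) t) (at t)"
proof (cases t "0::real" rule: linorder_cases)
  case less
  have "((\<lambda>t::real. 0::real) has_real_derivative 0) (at t)" by simp
  then have "(exp_bump k has_real_derivative 0) (at t)"
    by (rule has_field_derivative_transform_within_open[where S = "{..<0}"])
      (use less in \<open>auto simp: exp_bump_def\<close>)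
  then show ?thesis using less by (simp add: exp_bump_def)
next
  case equal
  \<comment> \<open>Division by \<open>h\<close> raises the exponent of \<open>inverse h\<close> by
    one, so the difference quotient at 0 is the next function of the family, whose limit is 0. At
    \<open>h = 0\<close> both sides are 0 by the convention on division.\<close>
  have "(\<lambda>h. (exp_bump k (0 + h) - exp_bump k 0) / h) = exp_bump (Suc k)"
    by (rule ext) (simp add: exp_bump_def divide_inverse)
  then show ?thesis using exp_bump_tendsto equal
    by (simp add: DERIV_def exp_bump_def[of _ 0])
next
  case greater
  have "((\<lambda>t. exp (- inverse t) * inverse t ^ k) has_real_derivative
      exp (- inverse t) * (inverse t * inverse t) * inverse t ^ k
      - exp (- inverse t) * (real k * inverse t ^ (k - 1) * (inverse t * inverse t))) (at t)"
  proof -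
    have "(inverse has_real_derivative - (inverse t * inverse t)) (at t)"
      using DERIV_inverse[of t] greater by (simp add: power2_eq_square)
    from DERIV_mult[OF DERIV_fun_exp[OF DERIV_minus[OF this]] DERIV_power[OF this, of k]]
    show ?thesis by (simp add: algebra_simps)
  qed
  \<comment> \<open>For \<open>k = 0\<close> the truncated exponent \<open>k - 1\<close> is
    harmless, since its term carries the factor \<open>real k\<close>.\<close>
  also have "exp (- inverse t) * (inverse t * inverse t) * inverse t ^ k
      - exp (- inverse t) * (real k * inverse t ^ (k - 1) * (inverse t * inverse t))
      = exp_bump (k + 2) t - real k * exp_bump (Suc k) t"
    using greater by (cases k) (simp_all add: exp_bump_def)
  finally have "((\<lambda>t. exp (- inverse t) * inverse t ^ k) has_real_derivative
      exp_bump (k + 2) t - real k * exp_bump (Suc k) t) (at t)" .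
  then show ?thesis
    by (rule has_field_derivative_transform_within_open[where S = "{0<..}"])
      (use greater in \<open>auto simp: exp_bump_def\<close>)
qed

lemma Ck_on_exp_bump: "Ck_on n UNIV (exp_bump k)"
proof (induction n arbitrary: k)
  case 0
  have "isCont (exp_bump k) t" for t by (rule DERIV_isCont[OF exp_bump_deriv])
  then show ?case by (simp add: continuous_at_imp_continuous_on)
next
  case (Suc n)
  have "Ck_on n UNIV (\<lambda>t. v *\<^sub>R (exp_bump (k + 2) t + (- real k) *\<^sub>R exp_bump (Suc k) t))" for v :: real
    by (intro Ck_on_scaleR Ck_on_add Ck_on_const Suc.IH open_UNIV)
  then show ?case
    by (intro Ck_on_SucI[OF open_UNIV exp_bump_deriv[unfolded has_field_derivative_def]])
      (simp add: mult.commute)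
qed

text \<open>Coordinate boxes will contain the supports of bump functions. Adding a vector
  \<open>a\<close> to \<open>B\<close> gives the image of an interval times the smaller box under
  the continuous map taking \<open>(t, s)\<close> to \<open>t *\<^sub>R a + s\<close>.\<close>

lemma compact_box:
  fixes B :: "'e::real_normed_vector set"
  assumes "finite B"
  shows "compact {\<Sum>b\<in>B. c b *\<^sub>R b | c. \<forall>b\<in>B. \<bar>c b\<bar> \<le> r}"
  using assms
proof (induction B)
  case empty
  then show ?case by simp
next
  case (insert a B)
  let ?K = "\<lambda>B. {\<Sum>b\<in>B. c b *\<^sub>R b | c. \<forall>b\<in>B. \<bar>c b\<bar> \<le> r}"
  have "(\<lambda>(t, s). t *\<^sub>R a + s) ` ({-r..r} \<times> ?K B) = ?K (insert a B)"
  proof (intro subset_antisym subsetI)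
    fix x assume "x \<in> (\<lambda>(t, s). t *\<^sub>R a + s) ` ({-r..r} \<times> ?K B)"
    then obtain t c where tc: "t \<in> {-r..r}" "\<forall>b\<in>B. \<bar>c b\<bar> \<le> r"
        "x = t *\<^sub>R a + (\<Sum>b\<in>B. c b *\<^sub>R b)" by auto
    moreover have "(\<Sum>b\<in>B. c b *\<^sub>R b) = (\<Sum>b\<in>B. (c(a := t)) b *\<^sub>R b)"
      using insert.hyps by (intro sum.cong) auto
    ultimately show "x \<in> ?K (insert a B)"
      using insert.hyps by (intro CollectI exI[of _ "c(a := t)"]) auto
  next
    fix x assume "x \<in> ?K (insert a B)"
    then obtain c where "x = c a *\<^sub>R a + (\<Sum>b\<in>B. c b *\<^sub>R b)" "\<forall>b\<in>insert a B. \<bar>c b\<bar> \<le> r"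
      using insert.hyps by auto
    then show "x \<in> (\<lambda>(t, s). t *\<^sub>R a + s) ` ({-r..r} \<times> ?K B)"
      by (intro image_eqI[of _ _ "(c a, \<Sum>b\<in>B. c b *\<^sub>R b)"]) (auto simp: abs_le_iff)
  qed
  moreover have "compact ((\<lambda>(t, s). t *\<^sub>R a + s) ` ({-r..r} \<times> ?K B))"
    using insert.IH
    by (intro compact_continuous_image compact_Times)
      (auto intro!: continuous_intros simp: case_prod_beta)
  ultimately show ?case by simp
qed

text \<open>Take \<open>exp_bump 0\<close> of \<open>r\<^sup>2\<close> minus the squared coordinate
  distance \<open>q\<close> from \<open>u\<close>. Where this is nonzero, each coordinate of
  \<open>w - u\<close> has absolute value at most \<open>r\<close>, so the support lies in a compact
  box.\<close>

lemma bump_function: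
  fixes u :: "'e::finite_dim_banach"
  assumes "open S" "u \<in> S"
  obtains h :: "'e \<Rightarrow> real" and K
  where "smooth_on UNIV h" "h u > 0" "D1 h u = (\<lambda>_. 0)"
    "compact K" "K \<subseteq> S" "\<And>w. w \<notin> K \<Longrightarrow> h w = 0"
proof -
  obtain I and co :: "'e \<Rightarrow> 'e \<Rightarrow>\<^sub>L real"
    where co: "finite I" "\<And>x. (\<Sum>b\<in>I. co b x *\<^sub>R b) = x"
    using finite_dim_coordinates by blast
  obtain e where e: "e > 0" "cball u e \<subseteq> S"
    using assms by (meson open_contains_cball)
  \<comment> \<open>\<open>M\<close> bounds the norms in a box of half-width 1, so half-width
    \<open>r = e / M\<close> keeps the box in the ball of radius \<open>e\<close>. The added 1 keeps
    \<open>M\<close> positive in the zero space.\<close>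
  define M where "M = (\<Sum>b\<in>I. norm b) + 1"
  have "M > 0" by (simp add: M_def add_nonneg_pos sum_nonneg)
  define r where "r = e / M"
  have r: "r > 0" using e \<open>M > 0\<close> by (simp add: r_def)
  define K where "K = (+) u ` {\<Sum>b\<in>I. c b *\<^sub>R b | c. \<forall>b\<in>I. \<bar>c b\<bar> \<le> r}"
  define q where "q w = (\<Sum>b\<in>I. co b (w - u) * co b (w - u))" for w
  define h where "h w = exp_bump 0 (r\<^sup>2 - q w)" for w
  have "smooth_on UNIV (\<lambda>w. co b (w - u) * co b (w - u))" for b
    by (intro smooth_on_mult smooth_on_diff_const open_UNIV)
  then have "Ck_on n UNIV q" for n
    unfolding q_def by (intro Ck_on_sum open_UNIV) (simp add: smooth_on_def)
  then have "Ck_on n UNIV (\<lambda>w. r\<^sup>2 + (-1) *\<^sub>R q w)" for n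
    by (intro Ck_on_add Ck_on_scaleR Ck_on_const open_UNIV)
  then have "Ck_on n UNIV h" for n
    unfolding h_def
    by (intro Ck_on_compose[OF open_UNIV open_UNIV _ _ Ck_on_exp_bump]) auto
  then have smooth: "smooth_on UNIV h" by (simp add: smooth_on_def)
  moreover have pos: "h u > 0" using r by (simp add: h_def q_def exp_bump_def)
  \<comment> \<open>\<open>u\<close> is a global maximum of \<open>h\<close>, because
    \<open>q\<close> is nonnegative and vanishes at \<open>u\<close>.\<close>
  moreover have "D1 h u = (\<lambda>_. 0)"
  proof (rule differential_zero_maxmin[OF UNIV_I open_UNIV
        has_derivative_D1[OF smooth_onD(1)[OF smooth UNIV_I]]])
    have "h w \<le> h u" for w
    proof -
      have "q w \<ge> 0" by (simp add: q_def sum_nonneg)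
      then show ?thesis using pos r
        by (auto simp: h_def q_def[of u] exp_bump_def field_simps)
    qed
    then show "(\<forall>w\<in>UNIV. h w \<le> h u) \<or> (\<forall>w\<in>UNIV. h u \<le> h w)" by blast
  qed
  moreover have "compact K"
    unfolding K_def by (intro compact_translation compact_box co)
  moreover have "K \<subseteq> S"
  proof
    fix x assume "x \<in> K"
    then obtain c where c: "x = u + (\<Sum>b\<in>I. c b *\<^sub>R b)" "\<forall>b\<in>I. \<bar>c b\<bar> \<le> r"
      by (auto simp: K_def)
    have "dist u x \<le> (\<Sum>b\<in>I. \<bar>c b\<bar> * norm b)"
      using norm_sum[of "\<lambda>b. c b *\<^sub>R b" I] by (simp add: c dist_norm)
    also have "\<dots> \<le> (\<Sum>b\<in>I. r * norm b)"
      using c(2) by (intro sum_mono mult_right_mono) auto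
    also have "\<dots> \<le> r * M" using r by (simp add: M_def sum_distrib_left distrib_left)
    also have "\<dots> = e" using \<open>M > 0\<close> by (simp add: r_def)
    finally show "x \<in> S" using e by auto
  qed
  moreover have "h w = 0" if "w \<notin> K" for w
  proof (rule ccontr)
    assume "h w \<noteq> 0"
    then have q: "q w < r\<^sup>2" by (auto simp: h_def exp_bump_def split: if_splits)
    have "\<bar>co b (w - u)\<bar> \<le> r" if "b \<in> I" for b
    proof -
      have "(co b (w - u))\<^sup>2 \<le> q w"
        unfolding q_def power2_eq_square using co(1) that
        by (intro member_le_sum) auto
      then have "(co b (w - u))\<^sup>2 \<le> r\<^sup>2" using q by simp
      then show ?thesis using r abs_le_square_iff[of "co b (w - u)" r] by simp
    qed
    then have "w - u \<in> {\<Sum>b\<in>I. c b *\<^sub>R b | c. \<forall>b\<in>I. \<bar>c b\<bar> \<le> r}"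
      using co(2)[of "w - u"] by (intro CollectI exI[of _ "\<lambda>b. co b (w - u)"]) simp
    then have "w \<in> K" unfolding K_def by (intro image_eqI[of _ _ "w - u"]) auto
    with that show False ..
  qed
  ultimately show thesis by (rule that)
qed

section \<open>Charts\<close>

lemma is_chartD:
  assumes "is_chart c"
  shows "open (chart_dom c)" "open (chart_im c)"
    "continuous_on (chart_dom c) (chart_map c)" "continuous_on (chart_im c) (param c)"
    "m \<in> chart_dom c \<Longrightarrow> chart_map c m \<in> chart_im c"
    "u \<in> chart_im c \<Longrightarrow> param c u \<in> chart_dom c"
    "m \<in> chart_dom c \<Longrightarrow> param c (chart_map c m) = m"
    "u \<in> chart_im c \<Longrightarrow> chart_map c (param c u) = u"
  using assms unfolding is_chart_def homeomorphism_def by auto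

lemma open_chart_overlap:
  assumes "is_chart c" "is_chart d"
  shows "open (chart_map c ` (chart_dom c \<inter> chart_dom d))"
proof -
  note c = is_chartD[OF assms(1)] and d = is_chartD[OF assms(2)]
  have "chart_map c ` (chart_dom c \<inter> chart_dom d) = param c -` chart_dom d \<inter> chart_im c"
    using c(5-8) by (force simp: image_iff)
  then show ?thesis
    using continuous_on_open_vimage[OF c(2), of "param c"] c(4) d(1) by simp
qed

lemma transition_overlap:
  assumes "is_chart c" "is_chart d" "v \<in> chart_map d ` (chart_dom c \<inter> chart_dom d)"
  shows "transition d c v \<in> chart_im c" "fun_rep c f (transition d c v) = fun_rep d f v"
  using assms is_chartD(5,7)[OF assms(1)] is_chartD(7)[OF assms(2)]
  by (auto simp: transition_def fun_rep_def)

text \<open>Around points over \<open>chart_dom c\<close> the representative in another chart is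
  \<open>F\<close> composed with a transition map. All other points avoid the image of
  \<open>K\<close> under \<open>param c\<close>, which is compact, hence closed as the space is
  Hausdorff, so the function vanishes on a neighbourhood.\<close>

lemma extend_by_zero_smooth:
  fixes A :: "('m::t2_space, 'e::finite_dim_banach) chart set"
  assumes A: "smooth_structure A" "c \<in> A" and F: "smooth_on (chart_im c) F"
    and K: "compact K" "K \<subseteq> chart_im c" "\<And>w. w \<notin> K \<Longrightarrow> F w = 0"
  shows "(\<lambda>m. if m \<in> chart_dom c then F (chart_map c m) else 0) \<in> smooth_functions A"
    (is "?f \<in> _")
proof -
  have ch: "is_chart d" if "d \<in> A" for d using A that by (simp add: smooth_structure_def)
  note c = is_chartD[OF ch[OF A(2)]]
  have "compact (param c ` K)"
    using continuous_on_subset[OF c(4) K(2)] K(1) by (rule compact_continuous_image)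
  then have cl: "closed (param c ` K)" by (rule compact_imp_closed)
  have "Ck_on n (chart_im d) (fun_rep d ?f)" if d: "d \<in> A" for d n
  proof (rule Ck_on_local)
    fix v assume v: "v \<in> chart_im d"
    note d' = is_chartD[OF ch[OF d]]
    show "\<exists>U. open U \<and> v \<in> U \<and> Ck_on n U (fun_rep d ?f)"
    proof (cases "param d v \<in> chart_dom c")
      case True
      let ?U = "chart_map d ` (chart_dom c \<inter> chart_dom d)"
      have U: "open ?U"
        using open_chart_overlap[OF ch[OF d] ch[OF A(2)]] by (simp add: Int_commute)
      have "smooth_on ?U (transition d c)"
        using A d by (simp add: smooth_structure_def smoothly_compatible_def)
      then have T: "Ck_on n ?U (transition d c)" unfolding smooth_on_def by blast
      have im: "transition d c ` ?U \<subseteq> chart_im c"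
        using transition_overlap(1)[OF ch[OF A(2)] ch[OF d]] by blast
      have "Ck_on n (chart_im c) F" using F unfolding smooth_on_def by blast
      from Ck_on_compose[OF U c(2) im T this]
      have "Ck_on n ?U (\<lambda>w. F (transition d c w))" .
      then have "Ck_on n ?U (fun_rep d ?f)"
        by (rule Ck_on_cong[OF U]) (auto simp: fun_rep_def transition_def d'(7))
      moreover have "v \<in> ?U" using True d'(6,8)[OF v] by (intro image_eqI[of _ _ "param d v"]) auto
      ultimately show ?thesis using U by blast
    next
      case False
      let ?U = "param d -` (- param c ` K) \<inter> chart_im d"
      have U: "open ?U"
        using continuous_on_open_vimage[OF d'(2), of "param d"] d'(4) cl by auto
      have "fun_rep d ?f w = 0" if "w \<in> ?U" for w
      proof -
        have "chart_map c (param d w) \<notin> K" if "param d w \<in> chart_dom c"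
          using \<open>w \<in> ?U\<close> c(7)[OF that] by (auto simp: image_iff)
        then show ?thesis using K(3) by (auto simp: fun_rep_def)
      qed
      then have "Ck_on n ?U (fun_rep d ?f)"
        by (intro Ck_on_cong[OF U Ck_on_const[of n _ 0]]) simp
      moreover have "v \<in> ?U" using False v K(2) c(6) by auto
      ultimately show ?thesis using U by blast
    qed
  qed
  then show ?thesis by (simp add: smooth_functions_def smooth_on_def)
qed

text \<open>The witness is \<open>(\<alpha> + l (w - u)) * k (w - u) * h w\<close> with a bump function \<open>h\<close>. As \<open>Dh\<close> and the
  polynomial factor vanish at \<open>u\<close>, only \<open>a = h u\<close> enters the \<open>2\<close>-jet, and \<open>h\<close> need not be constant
  near \<open>u\<close>.\<close>

lemma prescribed_2_jet:
  fixes A :: "('m::t2_space, 'e::finite_dim_banach) chart set"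
  assumes A: "smooth_structure A" "c \<in> A" and u: "u \<in> chart_im c"
  obtains a where "a > 0"
    "\<And>\<alpha> (l :: 'e \<Rightarrow>\<^sub>L real) (k :: 'e \<Rightarrow>\<^sub>L real). \<exists>f\<in>smooth_functions A.
      D1 (fun_rep c f) u = (\<lambda>v. a * (\<alpha> * k v)) \<and>
      D2 (fun_rep c f) u = (\<lambda>x y. a * (l y * k x + l x * k y))"
proof -
  have "is_chart c" using A by (simp add: smooth_structure_def)
  note c = is_chartD[OF this]
  obtain h :: "'e \<Rightarrow> real" and K where h: "smooth_on UNIV h" "h u > 0" "D1 h u = (\<lambda>_. 0)"
    and K: "compact K" "K \<subseteq> chart_im c" "\<And>w. w \<notin> K \<Longrightarrow> h w = 0"
    by (rule bump_function[OF c(2) u]) blast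
  show thesis
  proof (rule that[OF h(2)])
    fix \<alpha> and l k :: "'e \<Rightarrow>\<^sub>L real"
    define p where "p w = (\<alpha> + l (w - u)) * k (w - u)" for w
    define p' where "p' w v = l v * k (w - u) + (\<alpha> + l (w - u)) * k v" for w v
    define F where "F w = p w * h w" for w
    have l: "((\<lambda>w. blinfun_apply l (w - u)) has_derivative l) (at w)" for w and l :: "'e \<Rightarrow>\<^sub>L real"
      by (auto intro!: derivative_eq_intros)
    have p: "(p has_derivative p' w) (at w)" for w
      unfolding p_def p'_def
      by (rule has_derivative_eq_rhs[OF has_derivative_mult[OF
            has_derivative_add[OF has_derivative_const l] l]]) (auto simp: algebra_simps)
    have p': "((\<lambda>w. p' w v) has_derivative (\<lambda>x. l v * k x + l x * k v)) (at w)" for w v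
      unfolding p'_def
      by (rule has_derivative_eq_rhs[OF has_derivative_add[OF has_derivative_mult_right[OF l]
            has_derivative_mult_left[OF has_derivative_add[OF has_derivative_const l]]]]) auto
    note h' = has_derivative_D1[OF smooth_onD(1)[OF h(1) UNIV_I]]
    note h'' = has_derivative_D1[OF smooth_onD(1)[OF smooth_onD(2)[OF h(1)] UNIV_I]]
    have D1F: "D1 F w v = p w * D1 h w v + p' w v * h w" for w v
      unfolding F_def by (rule D1_eq[OF has_derivative_mult[OF p h']])
    have "D2 F u x y = (p u * D1 (\<lambda>w. D1 h w y) u x + p' u x * D1 h u y) +
        (p' u y * D1 h u x + (l y * k x + l x * k y) * h u)" for x y
      unfolding D2_def D1F
      by (rule D1_eq[OF has_derivative_add[OF has_derivative_mult[OF p h'']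
              has_derivative_mult[OF p' h']]])
    then have D2F: "D2 F u = (\<lambda>x y. h u * (l y * k x + l x * k y))"
      by (intro ext) (simp add: h(3) p_def mult.commute)
    have D1Fu: "D1 F u = (\<lambda>v. h u * (\<alpha> * k v))"
      by (rule ext) (simp add: D1F p_def p'_def)
    let ?f = "\<lambda>m. if m \<in> chart_dom c then F (chart_map c m) else 0"
    have "Ck_on n UNIV (\<lambda>w. \<alpha> + l (w - u))" for n
      using smooth_on_diff_const[OF open_UNIV, of l u]
      by (intro Ck_on_add open_UNIV Ck_on_const) (simp add: smooth_on_def)
    then have "smooth_on UNIV (\<lambda>w. \<alpha> + l (w - u))" by (simp add: smooth_on_def)
    then have sF: "smooth_on UNIV F"
      unfolding F_def p_def by (intro smooth_on_mult smooth_on_diff_const open_UNIV h)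
    have f: "?f \<in> smooth_functions A"
      by (rule extend_by_zero_smooth[OF A smooth_on_subset[OF sF subset_UNIV] K(1,2)])
        (simp add: F_def K(3))
    have rep: "fun_rep c ?f w = F w" if "w \<in> chart_im c" for w
      using c(6,8)[OF that] by (simp add: fun_rep_def)
    \<comment> \<open>\<open>D2\<close> differentiates \<open>D1\<close> again, so the first
      derivatives must agree on an open set and not just at \<open>u\<close>.\<close>
    have D1: "D1 (fun_rep c ?f) w = D1 F w" if "w \<in> chart_im c" for w
      by (rule D1_cong[OF c(2) that rep])
    have "D2 (fun_rep c ?f) u = D2 F u"
      unfolding D2_def
      by (intro ext fun_cong[OF D1_cong[OF c(2) u]]) (simp add: D1)
    then show "\<exists>f\<in>smooth_functions A. D1 (fun_rep c f) u = (\<lambda>v. h u * (\<alpha> * k v)) \<and>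
        D2 (fun_rep c f) u = (\<lambda>x y. h u * (l y * k x + l x * k y))"
      using f D1[OF u] D1Fu D2F by (intro bexI[of _ ?f]) auto
  qed
qed

section \<open>Covariant derivatives in a chart\<close>

text \<open>The description in \<open>lie_derivative\<close> is well defined because a change of
  chart composes the representative of \<open>g\<close> with a transition map, while
  \<open>TM\<close> transports \<open>X\<close> by the derivative of that same map. Asking only for
  differentiability of \<open>g\<close> at one point lets the lemma be iterated, on
  \<open>lie_derivative A Z f\<close> and on \<open>nabla2\<close>.\<close>

lemma fun_rep_lie_derivative:
  fixes A :: "('m::t2_space, 'e::finite_dim_banach) chart set"
  assumes A: "smooth_structure A" "c \<in> A" and X: "X \<in> vector_fields A"
    and u: "u \<in> chart_im c" and g: "fun_rep c g differentiable (at u)"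
  shows "fun_rep c (lie_derivative A X g) u = D1 (fun_rep c g) u (section_rep c X u)"
proof -
  have ch: "is_chart d" if "d \<in> A" for d using A that by (simp add: smooth_structure_def)
  note c = is_chartD[OF ch[OF A(2)]]
  define m where "m = param c u"
  have m: "m \<in> chart_dom c" "chart_map c m = u" using c(6,8)[OF u] by (auto simp: m_def)
  have eq: "D1 (fun_rep c g) u (X m c) = D1 (fun_rep d g) (chart_map d m) (X m d)"
    if d: "d \<in> A" "m \<in> chart_dom d" for d
  proof -
    let ?U = "chart_map d ` (chart_dom c \<inter> chart_dom d)" and ?v = "chart_map d m"
    have U: "open ?U"
      using open_chart_overlap[OF ch[OF d(1)] ch[OF A(2)]] by (simp add: Int_commute)
    have v: "?v \<in> ?U" using m d by auto
    have "smooth_on ?U (transition d c)"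
      using A d by (simp add: smooth_structure_def smoothly_compatible_def)
    then have T: "(transition d c has_derivative D1 (transition d c) ?v) (at ?v)"
      using smooth_onD(1) v has_derivative_D1 by blast
    have "transition d c ?v = u"
      using m d is_chartD(7)[OF ch[OF d(1)]] by (simp add: transition_def)
    then have "((\<lambda>w. fun_rep c g (transition d c w)) has_derivative
        (\<lambda>x. D1 (fun_rep c g) u (D1 (transition d c) ?v x))) (at ?v)"
      using has_derivative_compose[OF T, of "fun_rep c g"] has_derivative_D1[OF g] by simp
    then have "(fun_rep d g has_derivative
        (\<lambda>x. D1 (fun_rep c g) u (D1 (transition d c) ?v x))) (at ?v)"
      by (rule has_derivative_transform_within_open[OF _ U v])
        (rule transition_overlap(2)[OF ch[OF A(2)] ch[OF d(1)]])
    moreover have "X m c = D1 (transition d c) ?v (X m d)"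
    proof -
      have "X m \<in> fibre A TM m" using X by (simp add: smooth_sections_def)
      then have "X m c = TM d c ?v (X m d)" using d m(1) A(2) unfolding fibre_def by blast
      then show ?thesis by (simp add: TM_def)
    qed
    ultimately show ?thesis by (simp add: D1_eq)
  qed
  have "lie_derivative A X g m = D1 (fun_rep c g) u (X m c)"
    unfolding lie_derivative_def
  proof (rule the_equality)
    show "\<forall>d\<in>A. m \<in> chart_dom d \<longrightarrow>
        D1 (fun_rep c g) u (X m c) = D1 (fun_rep d g) (chart_map d m) (X m d)"
      using eq by blast
    show "r = D1 (fun_rep c g) u (X m c)"
      if "\<forall>d\<in>A. m \<in> chart_dom d \<longrightarrow> r = D1 (fun_rep d g) (chart_map d m) (X m d)" for r
      using that m A(2) by auto
  qed
  then show ?thesis by (simp add: fun_rep_def section_rep_def m_def)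
qed

section \<open>Higher derivatives evaluated on vector fields\<close>

lemma linear_D2:
  assumes S: "open S" "u \<in> S" and F: "smooth_on S F"
  shows "linear (\<lambda>x. D2 F u x y)" "linear (D2 F u x)"
proof -
  note F' = has_derivative_D1[OF smooth_onD(1)[OF smooth_onD(2)[OF F] S(2)]]
  note lin = linear_D1[OF smooth_onD(1)[OF F]]
  show "linear (\<lambda>x. D2 F u x y)"
    unfolding D2_def by (rule has_derivative_linear[OF F'])
  show "linear (D2 F u x)"
  proof (rule linearI)
    fix y z
    have "D1 (\<lambda>w. D1 F w (y + z)) u x = D1 (\<lambda>w. D1 F w y + D1 F w z) u x"
      by (rule fun_cong[OF D1_cong[OF S linear_add[OF lin]]])
    also have "\<dots> = D1 (\<lambda>w. D1 F w y) u x + D1 (\<lambda>w. D1 F w z) u x"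
      by (rule D1_eq[OF has_derivative_add[OF F' F']])
    finally show "D2 F u x (y + z) = D2 F u x y + D2 F u x z" by (simp add: D2_def)
  next
    fix r y
    have "D1 (\<lambda>w. D1 F w (r *\<^sub>R y)) u x = D1 (\<lambda>w. r *\<^sub>R D1 F w y) u x"
      by (rule fun_cong[OF D1_cong[OF S linear_cmul[OF lin]]])
    also have "\<dots> = r *\<^sub>R D1 (\<lambda>w. D1 F w y) u x"
      by (rule D1_eq[OF has_derivative_scaleR_right[OF F']])
    finally show "D2 F u x (r *\<^sub>R y) = r *\<^sub>R D2 F u x y" by (simp add: D2_def)
  qed
qed

text \<open>The rule for linear families is used twice: first \<open>Y\<close> varies with the last
  argument fixed, then \<open>Z\<close> varies.\<close>

lemma has_derivative_D2_fields:
  fixes Y Z :: "'e::finite_dim_banach \<Rightarrow> 'e"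
  assumes S: "open S" "u \<in> S" and F: "smooth_on S F"
    and Y: "Y differentiable (at u)" and Z: "Z differentiable (at u)"
  shows "((\<lambda>w. D2 F w (Y w) (Z w)) has_derivative
    (\<lambda>x. D3 F u x (Y u) (Z u) + D2 F u (D1 Y u x) (Z u) + D2 F u (Y u) (D1 Z u x))) (at u)"
proof -
  have "(\<lambda>w. D2 F w y z) differentiable (at u)" for y z
    unfolding D2_def using smooth_onD(1)[OF smooth_onD(2)[OF smooth_onD(2)[OF F]] S(2)] .
  then have D: "((\<lambda>w. D2 F w (Y w) z) has_derivative
      (\<lambda>x. D3 F u x (Y u) z + D2 F u (D1 Y u x) z)) (at u)" for z
    unfolding D3_def
    by (intro has_derivative_linear_family[OF S linear_D2(1)[OF S(1) _ F] _ Y])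
  then have "(\<lambda>w. D2 F w (Y w) z) differentiable (at u)" for z
    by (auto simp: differentiable_def)
  then show ?thesis
    using has_derivative_linear_family[where B = "\<lambda>w. D2 F w (Y w)", OF S _ _ Z]
      linear_D2(2)[OF S(1) _ F]
    by (simp add: D1_eq[OF D])
qed

section \<open>Coordinate expansion of the second and third covariant derivatives of a
  function\<close>

locale connection_in_chart =
  fixes A :: "('m::t2_space, 'e::finite_dim_banach) chart set"
    and N :: "('m, 'e, 'e) connection" and c :: "('m, 'e) chart"
    and \<Gamma> :: "'e \<Rightarrow> 'e \<Rightarrow> 'e \<Rightarrow> 'e"
  assumes atlas: "smooth_structure A" and koszul: "koszul_connection A TM N"
    and chart: "c \<in> A" and christoffel: "christoffel_symbol A TM N c \<Gamma>"
begin

lemma open_im: "open (chart_im c)"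
  using atlas chart by (simp add: smooth_structure_def is_chart_def)

lemma smooth_rep:
  "f \<in> smooth_functions A \<Longrightarrow> smooth_on (chart_im c) (fun_rep c f)"
  using chart by (simp add: smooth_functions_def)

lemma smooth_section_rep:
  "X \<in> vector_fields A \<Longrightarrow> smooth_on (chart_im c) (section_rep c X)"
  using chart by (simp add: smooth_sections_def)

lemma connection_field:
  "X \<in> vector_fields A \<Longrightarrow> Y \<in> vector_fields A \<Longrightarrow> N X Y \<in> vector_fields A"
  using koszul by (simp add: koszul_connection_def)

lemma connection_rep:
  assumes "X \<in> vector_fields A" "Y \<in> vector_fields A" "u \<in> chart_im c"
  shows "section_rep c (N X Y) u = D1 (section_rep c Y) u (section_rep c X u)
    - \<Gamma> u (section_rep c X u) (section_rep c Y u)"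
  using christoffel assms by (simp add: christoffel_symbol_def)

lemma has_derivative_D1_field:
  assumes "smooth_on (chart_im c) F" "Z \<in> vector_fields A" "u \<in> chart_im c"
  shows "((\<lambda>w. D1 F w (section_rep c Z w)) has_derivative
    (\<lambda>x. D2 F u x (section_rep c Z u) + D1 F u (D1 (section_rep c Z) u x))) (at u)"
  unfolding D2_def
  by (intro has_derivative_linear_family[OF open_im assms(3)] linear_D1 smooth_onD(1)[OF assms(1)]
      smooth_onD(1)[OF smooth_onD(2)[OF assms(1)] assms(3)]
      smooth_onD(1)[OF smooth_section_rep[OF assms(2)] assms(3)])

text \<open>\<open>\<Gamma>(Y,Z) = DZ \<cdot> Y - \<nabla>\<^sub>YZ\<close> inherits its smoothness from \<open>\<nabla>\<close>.\<close>

lemma christoffel_differentiable: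
  assumes "Y \<in> vector_fields A" "Z \<in> vector_fields A" "u \<in> chart_im c"
  shows "(\<lambda>w. \<Gamma> w (section_rep c Y w) (section_rep c Z w)) differentiable (at u)"
proof -
  have "(\<lambda>w. D1 (section_rep c Z) w (section_rep c Y w)) differentiable (at u)"
    using has_derivative_D1_field[OF smooth_section_rep[OF assms(2)] assms(1,3)]
    by (auto simp: differentiable_def)
  then have "(\<lambda>w. D1 (section_rep c Z) w (section_rep c Y w) - section_rep c (N Y Z) w)
      differentiable (at u)"
    by (intro differentiable_diff smooth_onD(1)[OF smooth_section_rep[OF connection_field]] assms)
  then show ?thesis
    by (rule differentiable_cong[OF open_im assms(3), rotated])
      (simp add: connection_rep[OF assms(1,2)])
qed

lemma fun_rep_lie:
  assumes "f \<in> smooth_functions A" "X \<in> vector_fields A" "u \<in> chart_im c"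
  shows "fun_rep c (lie_derivative A X f) u = D1 (fun_rep c f) u (section_rep c X u)"
  using fun_rep_lie_derivative[OF atlas chart assms(2,3)] smooth_onD(1)[OF smooth_rep] assms
  by blast

text \<open>The derivative of \<open>Z\<close> along \<open>Y\<close> occurs in both parts of
  \<open>nabla2\<close> and cancels; \<Gamma>, subtracted in \<open>N Y Z\<close>, comes out with a
  plus sign.\<close>

lemma nabla2_rep:
  assumes f: "f \<in> smooth_functions A" and YZ: "Y \<in> vector_fields A" "Z \<in> vector_fields A"
    and u: "u \<in> chart_im c"
  shows "fun_rep c (nabla2 A N f Y Z) u =
    D2 (fun_rep c f) u (section_rep c Y u) (section_rep c Z u) +
    D1 (fun_rep c f) u (\<Gamma> u (section_rep c Y u) (section_rep c Z u))"
proof -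
  let ?F = "fun_rep c f" and ?y = "section_rep c Y u" and ?Z = "section_rep c Z"
  have "(fun_rep c (lie_derivative A Z f) has_derivative
      (\<lambda>x. D2 ?F u x (?Z u) + D1 ?F u (D1 ?Z u x))) (at u)"
    using has_derivative_D1_field[OF smooth_rep[OF f] YZ(2) u]
    by (rule has_derivative_transform_within_open[OF _ open_im u])
      (rule fun_rep_lie[OF f YZ(2), symmetric])
  then have "fun_rep c (lie_derivative A Y (lie_derivative A Z f)) u =
      D2 ?F u ?y (?Z u) + D1 ?F u (D1 ?Z u ?y)"
    by (subst fun_rep_lie_derivative[OF atlas chart YZ(1) u])
      (auto simp: differentiable_def D1_eq)
  moreover have "fun_rep c (lie_derivative A (N Y Z) f) u =
      D1 ?F u (D1 ?Z u ?y) - D1 ?F u (\<Gamma> u ?y (?Z u))"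
    using linear_D1[OF smooth_onD(1)[OF smooth_rep[OF f] u]]
    by (simp add: fun_rep_lie[OF f connection_field[OF YZ] u] connection_rep[OF YZ u] linear_diff)
  ultimately show ?thesis by (simp add: fun_rep_def nabla2_def)
qed

text \<open>Applying \<open>X\<close> to the chart form of \<open>nabla2\<close> produces
  derivatives of \<open>Y\<close> and \<open>Z\<close> along \<open>X\<close>. They cancel against
  those contained in \<open>N X Y\<close> and \<open>N X Z\<close>, leaving two of the three
  \<Gamma>-terms under \<open>D2\<close>; the third, \<open>D2 F u x (\<Gamma> u y z)\<close>, comes
  from differentiating the first-order term of \<open>nabla2\<close>.\<close>

lemma nabla3_rep:
  assumes f: "f \<in> smooth_functions A" and XYZ: "X \<in> vector_fields A" "Y \<in> vector_fields A"
      "Z \<in> vector_fields A"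
    and u: "u \<in> chart_im c"
  defines "F \<equiv> fun_rep c f" and "x \<equiv> section_rep c X u" and "y \<equiv> section_rep c Y u"
    and "z \<equiv> section_rep c Z u"
  shows "fun_rep c (nabla3 A N f X Y Z) u = D3 F u x y z
    + (D2 F u x (\<Gamma> u y z) + D2 F u y (\<Gamma> u x z) + D2 F u (\<Gamma> u x y) z)
    + D1 F u (D1 (\<lambda>w. \<Gamma> w (section_rep c Y w) (section_rep c Z w)) u x
        - \<Gamma> u (section_rep c (N X Y) u) z - \<Gamma> u y (section_rep c (N X Z) u))"
proof -
  let ?Y = "section_rep c Y" and ?Z = "section_rep c Z"
  let ?G = "\<lambda>w. \<Gamma> w (?Y w) (?Z w)"
  note F = smooth_rep[OF f, folded F_def]
  note lin = linear_D1[OF smooth_onD(1)[OF F u]] linear_D2[OF open_im u F]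
  have "((\<lambda>w. D2 F w (?Y w) (?Z w)) has_derivative
      (\<lambda>x. D3 F u x y z + D2 F u (D1 ?Y u x) z + D2 F u y (D1 ?Z u x))) (at u)"
    unfolding y_def z_def
    by (intro has_derivative_D2_fields[OF open_im u F] smooth_onD(1)[OF smooth_section_rep] XYZ u)
  moreover have "((\<lambda>w. D1 F w (?G w)) has_derivative
      (\<lambda>x. D2 F u x (\<Gamma> u y z) + D1 F u (D1 ?G u x))) (at u)"
    unfolding D2_def y_def z_def
    by (intro has_derivative_linear_family[OF open_im u] linear_D1 smooth_onD(1)[OF F]
        smooth_onD(1)[OF smooth_onD(2)[OF F] u] christoffel_differentiable XYZ u)
  ultimately have "((\<lambda>w. D2 F w (?Y w) (?Z w) + D1 F w (?G w)) has_derivative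
      (\<lambda>x. D3 F u x y z + D2 F u (D1 ?Y u x) z + D2 F u y (D1 ?Z u x)
        + (D2 F u x (\<Gamma> u y z) + D1 F u (D1 ?G u x)))) (at u)"
    by (rule has_derivative_add)
  then have n2: "(fun_rep c (nabla2 A N f Y Z) has_derivative
      (\<lambda>x. D3 F u x y z + D2 F u (D1 ?Y u x) z + D2 F u y (D1 ?Z u x)
        + (D2 F u x (\<Gamma> u y z) + D1 F u (D1 ?G u x)))) (at u)"
    by (rule has_derivative_transform_within_open[OF _ open_im u])
      (simp add: nabla2_rep[OF f XYZ(2,3)] F_def)
  have "fun_rep c (lie_derivative A X (nabla2 A N f Y Z)) u =
      D3 F u x y z + D2 F u (D1 ?Y u x) z + D2 F u y (D1 ?Z u x)
        + (D2 F u x (\<Gamma> u y z) + D1 F u (D1 ?G u x))"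
    using n2 by (subst fun_rep_lie_derivative[OF atlas chart XYZ(1) u])
      (auto simp: differentiable_def D1_eq x_def)
  \<comment> \<open>\<open>N X Y\<close> is expanded only inside \<open>D2\<close>; inside \<Gamma>
    it stays as it is, matching the claimed form of \<open>R\<close>.\<close>
  moreover have "fun_rep c (nabla2 A N f (N X Y) Z) u =
      D2 F u (D1 ?Y u x) z - D2 F u (\<Gamma> u x y) z + D1 F u (\<Gamma> u (section_rep c (N X Y) u) z)"
    by (simp add: nabla2_rep[OF f connection_field[OF XYZ(1,2)] XYZ(3) u]
        connection_rep[OF XYZ(1,2) u] linear_diff[OF lin(2)] F_def[symmetric] x_def[symmetric]
        y_def[symmetric] z_def[symmetric])
  moreover have "fun_rep c (nabla2 A N f Y (N X Z)) u =
      D2 F u y (D1 ?Z u x) - D2 F u y (\<Gamma> u x z) + D1 F u (\<Gamma> u y (section_rep c (N X Z) u))"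
    by (simp add: nabla2_rep[OF f XYZ(2) connection_field[OF XYZ(1,3)] u]
        connection_rep[OF XYZ(1,3) u] linear_diff[OF lin(3)] F_def[symmetric] x_def[symmetric]
        y_def[symmetric] z_def[symmetric])
  ultimately show ?thesis
    by (simp add: fun_rep_def nabla3_def linear_diff[OF lin(1)])
qed

end

section \<open>Separation by \<open>2\<close>-jets\<close>

text \<open>Evaluating a tensor, as a map from functionals to vectors, at \<open>l\<close> and then
  applying \<open>k\<close> is linear and agrees with the bilinear form on products up to the
  constant; uniqueness in the universal property does the rest. The factor 2 undoes the 1/2 in
  \<open>sym_prod_blinfun\<close>.\<close>

lemma sym_lift_product:
  fixes l k :: "'e::finite_dim_banach \<Rightarrow>\<^sub>L real"
  shows "sym_lift (\<lambda>x y. a * (l y * k x + l x * k y)) s =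
    2 * a * k (blinfun_apply (Rep_sym_tensor s) l)"
proof -
  let ?b = "\<lambda>x y. a * (l y * k x + l x * k y)"
  let ?L = "\<lambda>s. 2 * a * k (blinfun_apply (Rep_sym_tensor s) l)"
  have "bilinear ?b"
    by (auto simp: bilinear_def blinfun.bilinear_simps algebra_simps intro!: linearI)
  then have ex: "\<exists>!L. linear L \<and> (\<forall>y z. L (y \<triangle> z) = ?b y z)"
    by (rule sym_tensor_universal) (simp add: algebra_simps)
  have "linear ?L"
    by (rule linearI) (simp_all add: plus_sym_tensor.rep_eq scaleR_sym_tensor.rep_eq
        blinfun.bilinear_simps algebra_simps)
  moreover have "?L (y \<triangle> z) = ?b y z" for y z
    by (simp add: sym_prod.rep_eq sym_prod_blinfun.rep_eq blinfun.bilinear_simps algebra_simps)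
  ultimately have "sym_lift ?b = ?L"
    unfolding sym_lift_def by (intro the1_equality[OF ex]) blast
  then show ?thesis by simp
qed

lemma blinfun_separates:
  fixes x :: "'e::finite_dim_banach"
  assumes "\<And>k :: 'e \<Rightarrow>\<^sub>L real. k x = 0"
  shows "x = 0"
proof -
  obtain I and co :: "'e \<Rightarrow> 'e \<Rightarrow>\<^sub>L real" where "\<And>x. (\<Sum>b\<in>I. co b x *\<^sub>R b) = x"
    using finite_dim_coordinates by blast
  from this[of x] show ?thesis by (simp add: assms)
qed

section \<open>Comparison of coefficients in the two expansions of \<open>nabla3\<close>\<close>

theorem proposition5p5:
  fixes A :: "('m::t2_space, 'e::finite_dim_banach) chart set"
    and N :: "('m, 'e, 'e) connection"
    and Nt :: "('m, 'e, 'e \<times> 'e sym_tensor) connection"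
    and c :: "('m, 'e) chart"
    and \<Gamma> :: "'e \<Rightarrow> 'e \<Rightarrow> 'e \<Rightarrow> 'e"
    and R :: "'e \<Rightarrow> 'e \<Rightarrow> 'e sym_tensor \<Rightarrow> 'e"
    and C :: "'e \<Rightarrow> 'e \<Rightarrow> 'e sym_tensor \<Rightarrow> 'e sym_tensor"
  assumes "smooth_manifold A"
    and "koszul_connection A TM N"
    and "induced_connection A N Nt"
    and "c \<in> A"
    and "christoffel_symbol A TM N c \<Gamma>"
    and "special_christoffel_symbols A Nt c R C"
  shows "\<forall>X\<in>vector_fields A. \<forall>Y\<in>vector_fields A. \<forall>Z\<in>vector_fields A. \<forall>u\<in>chart_im c.
    (let x = section_rep c X u; y = section_rep c Y u; z = section_rep c Z u in
      C u x (y \<triangle> z) = x \<triangle> \<Gamma> u y z + y \<triangle> \<Gamma> u x z + z \<triangle> \<Gamma> u x y \<and>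
      R u x (y \<triangle> z) =
        D1 (\<lambda>w. \<Gamma> w (section_rep c Y w) (section_rep c Z w)) u x
        - \<Gamma> u (section_rep c (N X Y) u) z - \<Gamma> u y (section_rep c (N X Z) u))"
proof -
  have A: "smooth_structure A" using assms(1) by (simp add: smooth_manifold_def)
  interpret connection_in_chart A N c \<Gamma>
    using A assms(2,4,5) by unfold_locales
  show ?thesis
  proof (intro ballI)
    fix X Y Z u
    assume XYZ: "X \<in> vector_fields A" "Y \<in> vector_fields A" "Z \<in> vector_fields A"
      and u: "u \<in> chart_im c"
    define x y z where "x = section_rep c X u" and "y = section_rep c Y u"
      and "z = section_rep c Z u"
    define C' where "C' = x \<triangle> \<Gamma> u y z + y \<triangle> \<Gamma> u x z + z \<triangle> \<Gamma> u x y"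
    define R' where "R' = D1 (\<lambda>w. \<Gamma> w (section_rep c Y w) (section_rep c Z w)) u x
        - \<Gamma> u (section_rep c (N X Y) u) z - \<Gamma> u y (section_rep c (N X Z) u)"
    obtain a where a: "a > 0" and jet:
      "\<And>\<alpha> (l :: 'e \<Rightarrow>\<^sub>L real) (k :: 'e \<Rightarrow>\<^sub>L real). \<exists>f\<in>smooth_functions A.
        D1 (fun_rep c f) u = (\<lambda>v. a * (\<alpha> * k v)) \<and>
        D2 (fun_rep c f) u = (\<lambda>x y. a * (l y * k x + l x * k y))"
      by (rule prescribed_2_jet[OF A assms(4) u]) blast
    \<comment> \<open>One identity for all \<open>l\<close>, \<open>k\<close> and
      \<open>\<alpha>\<close>, so that the two unknown differences can be separated by specialising
      \<open>l\<close> and \<open>\<alpha>\<close>. The common positive factor \<open>a\<close> of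
      the jets is divided out at the end.\<close>
    have key: "2 * k (blinfun_apply (Rep_sym_tensor (C u x (y \<triangle> z) - C')) l) +
        \<alpha> * k (R u x (y \<triangle> z) - R') = 0" for \<alpha> and l k :: "'e \<Rightarrow>\<^sub>L real"
    proof -
      obtain f where f: "f \<in> smooth_functions A"
        and D1: "D1 (fun_rep c f) u = (\<lambda>v. a * (\<alpha> * k v))"
        and D2: "D2 (fun_rep c f) u = (\<lambda>x y. a * (l y * k x + l x * k y))"
        using jet by blast
      let ?T = "\<lambda>s. 2 * a * k (blinfun_apply (Rep_sym_tensor s) l)"
      \<comment> \<open>Turns values of the second derivative on pairs of vectors into values of one
        linear functional of the tensor, so that the \<Gamma>-terms of \<open>nabla3_rep\<close> can
        be collected into \<open>C'\<close>.\<close>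
      have T: "a * (l y * k x + l x * k y) = ?T (x \<triangle> y)" for x y
        by (simp add: sym_prod.rep_eq sym_prod_blinfun.rep_eq blinfun.bilinear_simps algebra_simps)
      have "fun_rep c (nabla3 A N f X Y Z) u = D3 (fun_rep c f) u x y z +
          sym_lift (D2 (fun_rep c f) u) (C u x (y \<triangle> z)) +
          D1 (fun_rep c f) u (R u x (y \<triangle> z))"
        using assms(3,4,6) f XYZ u
        unfolding induced_connection_def Let_def x_def y_def z_def by blast
      \<comment> \<open>The third derivatives are the same on both sides and cancel, so prescribing
        2-jets is enough.\<close>
      then have "?T (C u x (y \<triangle> z)) + a * (\<alpha> * k (R u x (y \<triangle> z))) =
          ?T (x \<triangle> \<Gamma> u y z) + ?T (y \<triangle> \<Gamma> u x z) + ?T (\<Gamma> u x y \<triangle> z) + a * (\<alpha> * k R')"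
        unfolding nabla3_rep[OF f XYZ u, folded x_def y_def z_def, folded R'_def]
          D1 D2 sym_lift_product unfolding T by linarith
      then have "a * (2 * k (blinfun_apply (Rep_sym_tensor (C u x (y \<triangle> z) - C')) l) +
          \<alpha> * k (R u x (y \<triangle> z) - R')) = 0"
        by (simp add: C'_def sym_prod_commute[of _ z] plus_sym_tensor.rep_eq
            minus_sym_tensor.rep_eq blinfun.bilinear_simps algebra_simps)
      then show ?thesis using a by simp
    qed
    \<comment> \<open>With \<open>l = 0\<close> the second derivative of the test function vanishes
      at \<open>u\<close> and only the first-order coefficients remain.\<close>
    have "R u x (y \<triangle> z) - R' = 0"
      by (rule blinfun_separates)
        (use key[where \<alpha> = 1 and l = 0] in \<open>simp add: blinfun.bilinear_simps\<close>)
    moreover have "C u x (y \<triangle> z) - C' = 0"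
    proof -
      \<comment> \<open>With \<open>\<alpha> = 0\<close> the first derivative vanishes. Varying
        \<open>k\<close> shows that the vector obtained at \<open>l\<close> is zero; varying
        \<open>l\<close> then shows that the tensor is zero as a map on functionals.\<close>
      have "blinfun_apply (Rep_sym_tensor (C u x (y \<triangle> z) - C')) l = 0" for l
        by (rule blinfun_separates) (use key[where \<alpha> = 0] in simp)
      then have "Rep_sym_tensor (C u x (y \<triangle> z) - C') = 0"
        by (intro blinfun_eqI) simp
      then show ?thesis by (simp add: zero_sym_tensor.rep_eq flip: Rep_sym_tensor_inject)
    qed
    ultimately show "let x = section_rep c X u; y = section_rep c Y u; z = section_rep c Z u in
      C u x (y \<triangle> z) = x \<triangle> \<Gamma> u y z + y \<triangle> \<Gamma> u x z + z \<triangle> \<Gamma> u x y \<and>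
      R u x (y \<triangle> z) =
        D1 (\<lambda>w. \<Gamma> w (section_rep c Y w) (section_rep c Z w)) u x
        - \<Gamma> u (section_rep c (N X Y) u) z - \<Gamma> u y (section_rep c (N X Z) u)"
      by (simp add: Let_def C'_def R'_def x_def y_def z_def)
  qed
qed

end
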